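(* Let $d\in\mathbb{N}$ and let $\{X(\mathbf{t})\}$ be a centered stationary Gaussian field with a.s. continuous sample paths, unit variance and correlation function $r$ that satisfies, with some constants $\alpha_1,\ldots,\alpha_d\in(0,2]$ and some $R\in[0,\infty)$, $$r(\mathbf{t})=1-\sum_{i=1}^d|t_i|^{\alpha_i}+o\Big(\sum_{i=1}^d|t_i|^{\alpha_i}\Big)\ \text{ as } \mathbf{t}\to\mathbf{0},\qquad r(\mathbf{t})\log\sqrt{t_1^2+\cdots+t_d^2}\to R\ \text{ as } t_1^2+\cdots+t_d^2\to\infty .$$ Let $\mathcal{J}\subset\mathbb{R}^d$ be a Jordan-measurable set with Lebesgue measure $\lambda(\mathcal{J})>0$. Let $\bar m_1,\ldots,\bar m_d$ be positive functions with $\bar m_1(u)\bar m_2(u)\cdots\bar m_d(u)=m(u)$ such that for some integers $0\leqslant j\leqslant k<d$: (0) for every $i\in\{1,\ldots,j\}$, $\bar m_i(u)\to0$ as $u\to\infty$; (1) for every $i\in\{j+1,\ldots,k\}$ there exists $\bar M_i\in(0,\infty)$ such that $\bar m_i(u)\to\bar M_i$ as $u\to\infty$; (2) for every $i\in\{k+1,\ldots,d\}$, $\bar m_i(u)\to\infty$ as $u\to\infty$ and $\bar m_i(u)=\exp(\bar\gamma_iu^2)\bar c_i(u)$ for some constant $\bar\gamma_i\geqslant0$ and function $\bar c_i$ with $\log\bar c_i(u)=o(u^2)$ as $u\to\infty$. Assume moreover that $\bar m_1(u)=\exp(-\kappa u^2)c(u)$ for some constant $\kappa>0$ and some function $c$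 with $\log c(u)=o(u^2)$ as $u\to\infty$. Then, for each $A>0$, $$\mathbb{P}\left(\sup_{\mathbf{t}\in\mathcal{J}^{\mathbf{x}}_{\bar{\mathbf{m}}}}X(\mathbf{t})\leqslant u\right)\to0\qquad\text{as } u\to\infty,$$ uniformly for $\mathbf{x}\in[A,\infty)^d$.
   Context: Field: $\{X(\mathbf{t}):\mathbf{t}\in\mathbb{R}^d\}$, $\mathbf{t}=(t_1,\ldots,t_d)$, real-valued; $r(\mathbf{t})=\operatorname{Cov}(X(\mathbf{t}),X(\mathbf{0}))$, so by stationarity $\operatorname{Cov}(X(\mathbf{s}+\mathbf{t}),X(\mathbf{s}))=r(\mathbf{t})$ for $\mathbf{s},\mathbf{t}\in\mathbb{R}^d$. Let $\Psi(u)=\mathbb{P}(\mathcal{W}>u)$ for $\mathcal{W}\sim N(0,1)$. For $\alpha\in(0,2]$ the Pickands constant is $$\mathcal{H}_\alpha=\lim_{T\to\infty}\frac1T\,\mathbb{E}\exp\Big(\max_{0\leqslant t\leqslant T}\big(\sqrt2\,B_{\alpha/2}(t)-t^\alpha\big)\Big),$$ where $B_{\alpha/2}$ is a fractional Brownian motion with Hurst index $\alpha/2$ and $\operatorname{Var}B_{\alpha/2}(t)=t^\alpha$. For $u>0$ put $$m(u)=\Big(\prod_{i=1}^d\big(\mathcal{H}_{\alpha_i}u^{2/\alpha_i}\big)\,\Psi(u)\Big)^{-1}.$$ All functions $\bar m_i$ are functions of $u>0$. For $\mathbf{x}\in(0,\infty)^d$ and $\bar{\mathbf{m}}=(\bar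 m_1,\ldots,\bar m_d)$, $$\mathcal{J}^{\mathbf{x}}_{\bar{\mathbf{m}}}=\Big\{\mathbf{t}\in\mathbb{R}^d:\Big(\tfrac{t_1}{x_1\bar m_1(u)},\ldots,\tfrac{t_d}{x_d\bar m_d(u)}\Big)\in\mathcal{J}\Big\}$$ (depending on $u$). Jordan-measurable sets are bounded, with boundary of Lebesgue measure zero. *)

theory Defs
  imports "HOL-Probability.Probability"
begin

section \<open>Gaussian processes\<close>

text \<open>Constants count as (degenerate) Gaussian random variables.\<close>

definition gaussian_rv :: "'w measure \<Rightarrow> ('w \<Rightarrow> real) \<Rightarrow> bool" where
  "gaussian_rv M Y \<longleftrightarrow> Y \<in> borel_measurable M \<and>
     ((\<exists>\<mu> \<sigma>. 0 < \<sigma> \<and> distributed M lborel Y (normal_density \<mu> \<sigma>)) \<or>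
      (\<exists>\<mu>. AE \<omega> in M. Y \<omega> = \<mu>))"

definition gaussian_process :: "'w measure \<Rightarrow> 't set \<Rightarrow> ('t \<Rightarrow> 'w \<Rightarrow> real) \<Rightarrow> bool" where
  "gaussian_process M T X \<longleftrightarrow>
     (\<forall>S c. finite S \<and> S \<subseteq> T \<longrightarrow> gaussian_rv M (\<lambda>\<omega>. \<Sum>t\<in>S. c t * X t \<omega>))"

definition centered_process :: "'w measure \<Rightarrow> 't set \<Rightarrow> ('t \<Rightarrow> 'w \<Rightarrow> real) \<Rightarrow> bool" where
  "centered_process M T X \<longleftrightarrow> (\<forall>t\<in>T. (LINT \<omega>|M. X t \<omega>) = 0)"

definition covariance :: "'w measure \<Rightarrow> ('w \<Rightarrow> real) \<Rightarrow> ('w \<Rightarrow> real) \<Rightarrow> real" where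
  "covariance M Y Z =
     (LINT \<omega>|M. (Y \<omega> - (LINT \<omega>'|M. Y \<omega>')) * (Z \<omega> - (LINT \<omega>'|M. Z \<omega>')))"

text \<open>Strict stationarity: the finite-dimensional distributions are invariant under shifts.\<close>

definition stationary_field :: "'w measure \<Rightarrow> ('t::ab_group_add \<Rightarrow> 'w \<Rightarrow> real) \<Rightarrow> bool" where
  "stationary_field M X \<longleftrightarrow>
     (\<forall>h I. finite I \<longrightarrow>
        distr M (\<Pi>\<^sub>M t\<in>I. borel) (\<lambda>\<omega>. \<lambda>t\<in>I. X (t + h) \<omega>) =
        distr M (\<Pi>\<^sub>M t\<in>I. borel) (\<lambda>\<omega>. \<lambda>t\<in>I. X t \<omega>))"


section \<open>Pickands constants\<close>

definition fractional_brownian_motion ::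
    "'w measure \<Rightarrow> real \<Rightarrow> (real \<Rightarrow> 'w \<Rightarrow> real) \<Rightarrow> bool" where
  "fractional_brownian_motion M H B \<longleftrightarrow>
     prob_space M \<and> gaussian_process M {0..} B \<and> centered_process M {0..} B \<and>
     (\<forall>s\<ge>0. \<forall>t\<ge>0. covariance M (B s) (B t) =
        (s powr (2 * H) + t powr (2 * H) - \<bar>s - t\<bar> powr (2 * H)) / 2) \<and>
     (\<forall>\<omega>\<in>space M. continuous_on {0..} (\<lambda>t. B t \<omega>))"

text \<open>
  By continuity of the paths, the supremum below is a maximum and is measurable in \<open>\<omega>\<close>.
  The law of a fractional Brownian motion is determined by its covariance, so the
  expectation does not depend on the chosen realisation; every realisation has a copy on
  the path space \<open>real \<Rightarrow> real\<close>, so nothing is lost by fixing that sample space.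
\<close>

definition pickands :: "real \<Rightarrow> real" where
  "pickands \<alpha> =
     (THE h. \<exists>(M :: (real \<Rightarrow> real) measure) B.
        fractional_brownian_motion M (\<alpha> / 2) B \<and>
        ((\<lambda>T. 1 / T *
            (LINT \<omega>|M. exp (SUP t\<in>{0..T}. sqrt 2 * B t \<omega> - t powr \<alpha>)))
          \<longlongrightarrow> h) at_top)"


section \<open>Scaling\<close>

definition normal_tail :: "real \<Rightarrow> real" where
  "normal_tail u = measure (density lborel std_normal_density) {u<..}"

definition m_fun :: "('n::finite \<Rightarrow> real) \<Rightarrow> real \<Rightarrow> real" where
  "m_fun \<alpha> u =
     inverse ((\<Prod>i\<in>UNIV. pickands (\<alpha> i) * u powr (2 / \<alpha> i)) * normal_tail u)"

definition scaled_set ::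
    "(real ^ 'n) set \<Rightarrow> real ^ 'n \<Rightarrow> ('n::finite \<Rightarrow> real) \<Rightarrow> (real ^ 'n) set" where
  "scaled_set J x a = {t. (\<chi> i. t $ i / (x $ i * a i)) \<in> J}"

definition jordan_measurable :: "(real ^ 'n::finite) set \<Rightarrow> bool" where
  "jordan_measurable J \<longleftrightarrow> bounded J \<and> frontier J \<in> null_sets lebesgue"

text \<open>
  The probability of the event that the supremum of \<open>X\<close> over \<open>D\<close> is at most \<open>u\<close>. For a field with almost surely continuous paths this
  event agrees almost surely with a countable intersection of measurable events, but it need
  not itself be measurable when \<open>M\<close> is not complete (and \<open>measure\<close> is 0 on
  non-measurable sets); hence the completion. The supremum is taken in the extended reals, so that it
  is meaningful also on exceptional paths that are unbounded on \<open>D\<close>.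
\<close>

definition prob_sup_le :: "'w measure \<Rightarrow> ('t \<Rightarrow> 'w \<Rightarrow> real) \<Rightarrow> 't set \<Rightarrow> real \<Rightarrow> real" where
  "prob_sup_le M X D u =
     measure (completion M) {\<omega> \<in> space M. (SUP t\<in>D. ereal (X t \<omega>)) \<le> ereal u}"

end

theory Submission
  imports Defs "HOL-Real_Asymp.Real_Asymp"
begin

text \<open>
  Since \<open>ln (m u) \<ge> (1 / 2 - o(1)) u\<^sup>2\<close> and the first side length is as small as
  \<open>exp (- \<kappa> u\<^sup>2)\<close>, the directions with \<open>\<gamma> i > 0\<close> satisfy \<open>\<Sum>i. \<gamma> i > 1 / 2\<close>. Hence
  the scaled set contains, for a small \<open>\<theta> > 0\<close>, a translate of a grid of mesh \<open>exp (\<theta> u\<^sup>2)\<close>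
  with exponentially more than \<open>exp (u\<^sup>2 / 2)\<close> points, and it is enough to show that the maximum
  over these points exceeds \<open>u\<close> with high probability. On the grid all correlations are
  \<open>O(1 / u\<^sup>2)\<close>, and for most pairs they equal \<open>(l + o(1)) / u\<^sup>2\<close> with the same constant \<open>l\<close>.
  This common part does not vanish against \<open>u\<^sup>2\<close>, so it is removed by subtracting the average of
  the field over a few auxiliary points at the same logarithmic distance. That average is
  \<open>O(1 / u)\<close> in \<open>L\<^sup>2\<close>, which costs only a constant factor in the level, and for the difference
  field the second moment method applies to the number of exceedances. By stationarity the
  estimate does not depend on the translation, whence the uniformity in \<open>x\<close>.
\<close>

section \<open>Independence via characteristic functions\<close>

text \<open>The critical order of the correlations is 1 / u^2: dividing the joint density of two
  standard normal variables with small correlation rho by the product density gives about exp (rho x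
  y), and x, y are comparable to u. The second moment method tolerates a bounded factor for a
  fraction O(1 / u) of the pairs of grid points, but for the others it needs a factor close to 1,
  and this fails if they share a correlation l / u^2 with l > 0. That l is the same for nearly all
  pairs comes from the logarithm: most pairs lie, up to powers of u, at the distance exp (\<beta>
  u^2) set by the longest side of the grid, and ln of such a distance is \<beta> u^2 + O(ln u), so l
  = R / \<beta>. About u^3 auxiliary points suffice, since the individual variances then contribute
  only 1 / u^3 to the variance of the average, which is negligible against 1 / u^2. All losses are
  paid from the exponential surplus of points: it allows the level u to be raised to a u for a fixed
  a > 1, which covers both the random size of the average and the possibly smaller variance of the
  difference field.\<close>

lemma (in prob_space) weighted_distribution_eq:
  fixes X h :: "'a \<Rightarrow> real"
  assumes [measurable]: "X \<in> borel_measurable M" "h \<in> borel_measurable M"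
    and h: "\<And>\<omega>. 0 \<le> h \<omega>" "\<And>\<omega>. h \<omega> \<le> C"
    and char: "\<And>s. (CLINT \<omega>|M. iexp (s * X \<omega>) * h \<omega>) = char (distr M borel X) s * expectation h"
    and [measurable]: "A \<in> sets borel"
  shows "expectation (\<lambda>\<omega>. indicator A (X \<omega>) * h \<omega>) = prob (X -` A \<inter> space M) * expectation h"
proof -
  have inth: "integrable M h"
    by (rule integrable_const_bound[where B=C]) (use h in auto)
  show ?thesis
  proof (cases "expectation h = 0")
    case True
    then have "AE \<omega> in M. h \<omega> = 0"
      using integral_nonneg_eq_0_iff_AE[OF inth] h by auto
    then have "expectation (\<lambda>\<omega>. indicator A (X \<omega>) * h \<omega>) = expectation (\<lambda>\<omega>. 0)"
      by (intro integral_cong_AE) auto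
    with True show ?thesis by simp
  next
    case False
    define m where "m = expectation h"
    have m: "m > 0" using False h Bochner_Integration.integral_nonneg[of M h] unfolding m_def
      by (simp add: less_le)
    \<comment> \<open>Under the tilted measure \<open>Q\<close>, again a probability measure, X has
      an unchanged characteristic function and hence by Levy's theorem an unchanged law. In this way
      uniqueness on the line can handle a pair of variables.\<close>
    define Q where "Q = density M (\<lambda>\<omega>. h \<omega> / m)"
    have [measurable]: "X \<in> borel_measurable Q" by (simp add: Q_def)
    have "emeasure Q (space Q) = (\<integral>\<^sup>+\<omega>. ennreal (h \<omega> / m) \<partial>M)"
      by (auto simp: Q_def emeasure_density intro!: nn_integral_cong)
    also have "\<dots> = ennreal (expectation (\<lambda>\<omega>. h \<omega> / m))"
      by (rule nn_integral_eq_integral) (use inth h m in auto)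
    also have "\<dots> = 1" using m by (simp add: m_def)
    finally have "prob_space Q" by (rule prob_spaceI)
    then interpret Q: prob_space Q .
    interpret XQ: real_distribution "distr Q borel X" by (rule Q.real_distribution_distr) simp
    interpret XM: real_distribution "distr M borel X" by (rule real_distribution_distr) simp
    have "char (distr Q borel X) = char (distr M borel X)"
    proof
      fix s
      have "char (distr Q borel X) s = (CLINT \<omega>|Q. iexp (s * X \<omega>))"
        unfolding char_def by (rule integral_distr) measurable
      also have "\<dots> = (CLINT \<omega>|M. (h \<omega> / m) *\<^sub>R iexp (s * X \<omega>))"
        unfolding Q_def by (rule integral_density) (use h m in auto)
      also have "\<dots> = (CLINT \<omega>|M. (iexp (s * X \<omega>) * h \<omega>) / m)"
        by (simp add: scaleR_conv_of_real mult.commute)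
      also have "\<dots> = char (distr M borel X) s"
        using m char[of s] by (subst integral_divide_zero) (simp add: m_def)
      finally show "char (distr Q borel X) s = char (distr M borel X) s" .
    qed
    then have "distr Q borel X = distr M borel X"
      by (intro Levy_uniqueness) (unfold_locales)
    then have "measure (distr Q borel X) A = measure (distr M borel X) A" by simp
    then have *: "Q.prob (X -` A \<inter> space M) = prob (X -` A \<inter> space M)"
      by (simp add: measure_distr Q_def)
    have "Q.prob (X -` A \<inter> space M) = Q.expectation (indicator (X -` A \<inter> space M))"
      by (simp add: Q_def)
    also have "\<dots> = expectation (\<lambda>\<omega>. (h \<omega> / m) *\<^sub>R indicator (X -` A \<inter> space M) \<omega>)"
      unfolding Q_def by (rule integral_density) (use h m in auto)
    also have "\<dots> = expectation (\<lambda>\<omega>. (indicator A (X \<omega>) * h \<omega>) / m)"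
      by (intro Bochner_Integration.integral_cong) (auto simp: indicator_def)
    also have "\<dots> = expectation (\<lambda>\<omega>. indicator A (X \<omega>) * h \<omega>) / m"
      by simp
    finally show ?thesis using * m by (simp add: m_def field_simps)
  qed
qed

text \<open>One-dimensional uniqueness is used twice: with weights trigonometric in V it frees the
  event that X lies in A from every cos (t V + \<theta>), and then, with the indicator of that event
  as the weight, from the events in V.\<close>

lemma (in prob_space) joint_distribution_eq_pair_measure:
  fixes X V :: "'a \<Rightarrow> real"
  assumes [measurable]: "X \<in> borel_measurable M" "V \<in> borel_measurable M"
    and char: "\<And>s t. (CLINT \<omega>|M. iexp (s * X \<omega> + t * V \<omega>)) =
      char (distr M borel X) s * char (distr M borel V) t"
  shows "distr M (borel \<Otimes>\<^sub>M borel) (\<lambda>\<omega>. (X \<omega>, V \<omega>)) = distr M borel X \<Otimes>\<^sub>M distr M borel V"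
proof -
  interpret XM: real_distribution "distr M borel X" by (rule real_distribution_distr) simp
  interpret VM: real_distribution "distr M borel V" by (rule real_distribution_distr) simp
  have int: "integrable M (\<lambda>\<omega>. iexp (f \<omega>))" if "f \<in> borel_measurable M" for f
    using that by (intro integrable_iexp) auto
  have charV: "char (distr M borel V) t = (CLINT \<omega>|M. iexp (t * V \<omega>))" for t
    unfolding char_def by (rule integral_distr) measurable
  have charX: "char (distr M borel X) t = (CLINT \<omega>|M. iexp (t * X \<omega>))" for t
    unfolding char_def by (rule integral_distr) measurable
  \<comment> \<open>The phase \<theta> is carried along so that its values 0 and - pi / 2 yield both
    the real and the imaginary part of the characteristic function of V.\<close>
  have cos_iexp: "complex_of_real (cos (a + \<theta>)) = (iexp \<theta> * iexp a + iexp (-\<theta>) * iexp (-a)) / 2" for a \<theta>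
    by (simp add: complex_eq_iff cos_add exp_eq_polar Re_exp Im_exp algebra_simps)
  have A: "expectation (\<lambda>\<omega>. indicator A (X \<omega>) * cos (t * V \<omega> + \<theta>)) =
      prob (X -` A \<inter> space M) * expectation (\<lambda>\<omega>. cos (t * V \<omega> + \<theta>))"
    if [measurable]: "A \<in> sets borel" for A t \<theta>
  proof -
    \<comment> \<open>The weight has to be nonnegative, hence the summand 2; its contribution
      cancels at the end.\<close>
    let ?h = "\<lambda>\<omega>. 2 + cos (t * V \<omega> + \<theta>)"
    have intc: "integrable M (\<lambda>\<omega>. cos (t * V \<omega> + \<theta>))"
      by (rule integrable_const_bound[where B=1]) auto
    have inti: "integrable M (\<lambda>\<omega>. indicator A (X \<omega>) * cos (t * V \<omega> + \<theta>))"
      by (rule integrable_const_bound[where B=1]) (auto simp: indicator_def)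
    have "expectation (\<lambda>\<omega>. indicator A (X \<omega>) * ?h \<omega>) = prob (X -` A \<inter> space M) * expectation ?h"
    proof (rule weighted_distribution_eq)
      show "0 \<le> ?h \<omega>" for \<omega> using cos_ge_minus_one[of "t * V \<omega> + \<theta>"] by linarith
      show "?h \<omega> \<le> 3" for \<omega> using cos_le_one[of "t * V \<omega> + \<theta>"] by linarith
      fix s
      have c1: "(CLINT \<omega>|M. complex_of_real (cos (t * V \<omega> + \<theta>))) =
          (iexp \<theta> * char (distr M borel V) t + iexp (-\<theta>) * char (distr M borel V) (-t)) / 2"
        unfolding cos_iexp charV using int[of "\<lambda>\<omega>. t * V \<omega>"] int[of "\<lambda>\<omega>. - (t * V \<omega>)"]
        by (subst integral_divide_zero) (simp)
      have "(CLINT \<omega>|M. iexp (s * X \<omega>) * ?h \<omega>) =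
        (CLINT \<omega>|M. 2 * iexp (s * X \<omega>) + (iexp \<theta> * iexp (s * X \<omega> + t * V \<omega>)
            + iexp (-\<theta>) * iexp (s * X \<omega> + (-t) * V \<omega>)) / 2)"
        unfolding of_real_add cos_iexp
        by (intro Bochner_Integration.integral_cong) (auto simp: field_simps exp_add[symmetric] exp_diff)
      also have "\<dots> = 2 * (CLINT \<omega>|M. iexp (s * X \<omega>)) + (iexp \<theta> * (CLINT \<omega>|M. iexp (s * X \<omega> + t * V \<omega>))
            + iexp (-\<theta>) * (CLINT \<omega>|M. iexp (s * X \<omega> + (-t) * V \<omega>))) / 2"
        using int[of "\<lambda>\<omega>. s * X \<omega>"] int[of "\<lambda>\<omega>. s * X \<omega> + t * V \<omega>"] int[of "\<lambda>\<omega>. s * X \<omega> + (-t) * V \<omega>"]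
        by (subst Bochner_Integration.integral_add) auto
      also have "\<dots> = char (distr M borel X) s *
          (2 + (CLINT \<omega>|M. complex_of_real (cos (t * V \<omega> + \<theta>))))"
        unfolding char c1 charX[symmetric] by (simp add: algebra_simps)
      also have "(2 + (CLINT \<omega>|M. complex_of_real (cos (t * V \<omega> + \<theta>)))) = of_real (expectation ?h)"
        using intc by (simp add: prob_space)
      finally show "(CLINT \<omega>|M. iexp (s * X \<omega>) * ?h \<omega>) = char (distr M borel X) s * (expectation ?h)" .
    qed auto
    moreover have "expectation (\<lambda>\<omega>. indicator A (X \<omega>) * ?h \<omega>) =
        2 * prob (X -` A \<inter> space M) + expectation (\<lambda>\<omega>. indicator A (X \<omega>) * cos (t * V \<omega> + \<theta>))"
    proof -
      have "expectation (\<lambda>\<omega>. indicator A (X \<omega>) * ?h \<omega>) = expectation (\<lambda>\<omega>. 2 * indicator (X -` A \<inter> space M) \<omega>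
         + indicator A (X \<omega>) * cos (t * V \<omega> + \<theta>))"
        by (intro Bochner_Integration.integral_cong) (auto simp: indicator_def)
      also have "\<dots> = 2 * prob (X -` A \<inter> space M) + expectation (\<lambda>\<omega>. indicator A (X \<omega>) * cos (t * V \<omega> + \<theta>))"
        using inti by (subst Bochner_Integration.integral_add)
          (auto intro!: integrable_real_indicator simp: emeasure_eq_measure)
      finally show ?thesis .
    qed
    moreover have "expectation ?h = 2 + expectation (\<lambda>\<omega>. cos (t * V \<omega> + \<theta>))"
      using intc by (simp add: prob_space)
    ultimately show ?thesis by (simp add: algebra_simps)
  qed
  have B: "prob (X -` A \<inter> V -` B \<inter> space M) = prob (X -` A \<inter> space M) * prob (V -` B \<inter> space M)"
    if [measurable]: "A \<in> sets borel" "B \<in> sets borel" for A B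
  proof -
    have "expectation (\<lambda>\<omega>. indicator B (V \<omega>) * indicator A (X \<omega>)) =
        prob (V -` B \<inter> space M) * expectation (\<lambda>\<omega>. indicator A (X \<omega>))"
    proof (rule weighted_distribution_eq)
      fix t
      have *: "cos (x + - (pi/2)) = sin x" for x :: real
        by (simp add: cos_diff)
      have i1: "integrable M (\<lambda>\<omega>. indicator A (X \<omega>) * cos (t * V \<omega>))"
        by (rule integrable_const_bound[where B=1]) (auto simp: indicator_def)
      have i2: "integrable M (\<lambda>\<omega>. indicator A (X \<omega>) * sin (t * V \<omega>))"
        by (rule integrable_const_bound[where B=1]) (auto simp: indicator_def)
      have i3: "integrable M (\<lambda>\<omega>. cos (t * V \<omega>))" "integrable M (\<lambda>\<omega>. sin (t * V \<omega>))"
        by (auto intro!: integrable_const_bound[where B=1])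
      have iexp_eq: "iexp x = of_real (cos x) + \<i> * of_real (sin x)" for x
        by (simp add: cis_conv_exp[symmetric] cis.code complex_eq_iff)
      have "(CLINT \<omega>|M. iexp (t * V \<omega>) * (indicator A (X \<omega>) :: real)) =
         (CLINT \<omega>|M. of_real (indicator A (X \<omega>) * cos (t * V \<omega>)) + \<i> * of_real (indicator A (X \<omega>) * sin (t * V \<omega>)))"
        unfolding iexp_eq by (simp add: algebra_simps)
      also have "\<dots> = of_real (expectation (\<lambda>\<omega>. indicator A (X \<omega>) * cos (t * V \<omega>)))
         + \<i> * of_real (expectation (\<lambda>\<omega>. indicator A (X \<omega>) * sin (t * V \<omega>)))"
        using i1 i2 by (subst Bochner_Integration.integral_add)
          (auto simp del: of_real_mult simp: integral_complex_of_real intro!: integrable_mult_right integrable_of_real)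
      also have "\<dots> = prob (X -` A \<inter> space M) * (of_real (expectation (\<lambda>\<omega>. cos (t * V \<omega>)))
         + \<i> * of_real (expectation (\<lambda>\<omega>. sin (t * V \<omega>))))"
        using A[of A t 0] A[of A t "-(pi/2)"] by (simp only: *) (simp add: algebra_simps)
      also have "(of_real (expectation (\<lambda>\<omega>. cos (t * V \<omega>))) + \<i> * of_real (expectation (\<lambda>\<omega>. sin (t * V \<omega>))))
         = char (distr M borel V) t"
        unfolding charV iexp_eq using i3
        by (subst Bochner_Integration.integral_add) (auto simp: integral_complex_of_real)
      also have "prob (X -` A \<inter> space M) = expectation (\<lambda>\<omega>. indicat_real A (X \<omega>))"
        by (subst Bochner_Integration.integral_indicator[symmetric])
          (auto simp del: Bochner_Integration.integral_indicator intro!: Bochner_Integration.integral_cong simp: indicator_def)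
      finally show "(CLINT \<omega>|M. iexp (t * V \<omega>) * (indicator A (X \<omega>) :: real)) =
         char (distr M borel V) t * expectation (\<lambda>\<omega>. indicat_real A (X \<omega>))" by (simp add: mult.commute)
    qed (auto simp: indicator_def)
    moreover have "expectation (\<lambda>\<omega>. indicat_real A (X \<omega>)) = expectation (indicat_real (X -` A \<inter> space M))"
      by (intro Bochner_Integration.integral_cong) (auto simp: indicator_def)
    moreover have "expectation (\<lambda>\<omega>. indicat_real B (V \<omega>) * indicat_real A (X \<omega>)) =
        expectation (indicat_real (X -` A \<inter> V -` B \<inter> space M))"
      by (intro Bochner_Integration.integral_cong) (auto simp: indicator_def)
    moreover have "X -` A \<inter> V -` B \<inter> space M = (X -` A \<inter> space M) \<inter> (V -` B \<inter> space M)" by auto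
    then have "X -` A \<inter> V -` B \<inter> space M \<in> sets M" by simp
    ultimately show ?thesis by simp
  qed
  show ?thesis
  proof (rule pair_measure_eqI[symmetric])
    fix A B assume "A \<in> sets (distr M borel X)" "B \<in> sets (distr M borel V)"
    then have [measurable]: "A \<in> sets borel" "B \<in> sets borel" by auto
    have "emeasure (distr M (borel \<Otimes>\<^sub>M borel) (\<lambda>\<omega>. (X \<omega>, V \<omega>))) (A \<times> B) =
       emeasure M (X -` A \<inter> V -` B \<inter> space M)"
      by (subst emeasure_distr) (auto intro!: arg_cong[where f="emeasure M"])
    also have "\<dots> = emeasure M (X -` A \<inter> space M) * emeasure M (V -` B \<inter> space M)"
      using B[of A B] by (simp add: emeasure_eq_measure ennreal_mult)
    finally show "emeasure (distr M borel X) A * emeasure (distr M borel V) B =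
       emeasure (distr M (borel \<Otimes>\<^sub>M borel) (\<lambda>\<omega>. (X \<omega>, V \<omega>))) (A \<times> B)"
      by (simp add: emeasure_distr)
  qed (auto intro: XM.sigma_finite_measure_axioms VM.sigma_finite_measure_axioms)
qed

section \<open>Joint exceedances of Gaussian variables\<close>

text \<open>Both alternatives of \<open>gaussian_rv\<close> lead to one formula, because an almost
  surely constant variable with mean 0 vanishes. Linear combinations may degenerate, and this spares
  later proofs the distinction.\<close>

lemma (in prob_space) centered_gaussian_rv:
  assumes "gaussian_rv M Y" "expectation Y = 0"
  shows "integrable M (\<lambda>\<omega>. (Y \<omega>)\<^sup>2)"
    and "(CLINT \<omega>|M. iexp (Y \<omega>)) = exp (- expectation (\<lambda>\<omega>. (Y \<omega>)\<^sup>2) / 2)"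
proof -
  have [measurable]: "Y \<in> borel_measurable M" using assms(1) by (simp add: gaussian_rv_def)
  have "integrable M (\<lambda>\<omega>. (Y \<omega>)\<^sup>2) \<and> (CLINT \<omega>|M. iexp (Y \<omega>)) = exp (- expectation (\<lambda>\<omega>. (Y \<omega>)\<^sup>2) / 2)"
    using assms(1) unfolding gaussian_rv_def
  proof safe
    fix \<mu> \<sigma> :: real assume \<sigma>: "0 < \<sigma>" and D: "distributed M lborel Y (normal_density \<mu> \<sigma>)"
    have \<mu>: "\<mu> = 0" using normal_distributed_expectation[OF \<sigma> D] assms(2) by simp
    note D = D[unfolded \<mu>]
    have var: "expectation (\<lambda>\<omega>. (Y \<omega>)\<^sup>2) = \<sigma>\<^sup>2"
      using normal_distributed_variance[OF \<sigma> D] assms(2) by simp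
    show "integrable M (\<lambda>\<omega>. (Y \<omega>)\<^sup>2)"
      using distributed_integrable[OF D, of "\<lambda>x. x\<^sup>2"] integrable_normal_moment[OF \<sigma>, of 0 2] by simp
    have D': "distributed M lborel (\<lambda>\<omega>. Y \<omega> / \<sigma>) std_normal_density"
      using D normal_standard_normal_convert[OF \<sigma>, of Y 0] by simp
    have "distr M borel (\<lambda>\<omega>. Y \<omega> / \<sigma>) = std_normal_distribution"
      using distributed_distr_eq_density[OF D'] by (simp cong: distr_cong)
    then have "char std_normal_distribution \<sigma> = char (distr M borel (\<lambda>\<omega>. Y \<omega> / \<sigma>)) \<sigma>" by simp
    also have "\<dots> = (CLINT \<omega>|M. iexp (\<sigma> * (Y \<omega> / \<sigma>)))"
      unfolding char_def by (rule integral_distr) measurable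
    finally show "(CLINT \<omega>|M. iexp (Y \<omega>)) = exp (- expectation (\<lambda>\<omega>. (Y \<omega>)\<^sup>2) / 2)"
      using \<sigma> unfolding char_std_normal_distribution var by simp
  next
    fix \<mu> assume ae: "AE \<omega> in M. Y \<omega> = \<mu>"
    then have "expectation Y = expectation (\<lambda>\<omega>. \<mu>)" by (intro integral_cong_AE) auto
    then have "\<mu> = 0" using assms(2) by (simp add: prob_space)
    then have ae: "AE \<omega> in M. Y \<omega> = 0" using ae by simp
    have 1: "expectation (\<lambda>\<omega>. (Y \<omega>)\<^sup>2) = expectation (\<lambda>\<omega>. 0)" by (rule integral_cong_AE) (use ae in auto)
    have 2: "(CLINT \<omega>|M. iexp (Y \<omega>)) = (CLINT \<omega>|M. 1)" by (rule integral_cong_AE) (use ae in auto)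
    show "integrable M (\<lambda>\<omega>. (Y \<omega>)\<^sup>2)"
      by (subst integrable_cong_AE[where g="\<lambda>\<omega>. 0"]) (use ae in auto)
    show "(CLINT \<omega>|M. iexp (Y \<omega>)) = exp (- expectation (\<lambda>\<omega>. (Y \<omega>)\<^sup>2) / 2)"
      unfolding 1 2 by (simp add: prob_space)
  qed
  then show "integrable M (\<lambda>\<omega>. (Y \<omega>)\<^sup>2)"
    "(CLINT \<omega>|M. iexp (Y \<omega>)) = exp (- expectation (\<lambda>\<omega>. (Y \<omega>)\<^sup>2) / 2)" by auto
qed

text \<open>Closure under linear combinations is what lets covariances determine joint laws: the
  characteristic function of a pair (Y, Z) is read off from the variances of the members s Y + t
  Z.\<close>

locale gaussian_space = prob_space M for M :: "'w measure" +
  fixes H :: "('w \<Rightarrow> real) set"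
  assumes gaussian: "Y \<in> H \<Longrightarrow> gaussian_rv M Y"
    and centered: "Y \<in> H \<Longrightarrow> expectation Y = 0"
    and add_closed: "Y \<in> H \<Longrightarrow> Z \<in> H \<Longrightarrow> (\<lambda>\<omega>. Y \<omega> + Z \<omega>) \<in> H"
    and scale_closed: "Y \<in> H \<Longrightarrow> (\<lambda>\<omega>. a * Y \<omega>) \<in> H"
begin

abbreviation cov :: "('w \<Rightarrow> real) \<Rightarrow> ('w \<Rightarrow> real) \<Rightarrow> real" where
  "cov Y Z \<equiv> expectation (\<lambda>\<omega>. Y \<omega> * Z \<omega>)"

lemma diff_closed: "Y \<in> H \<Longrightarrow> Z \<in> H \<Longrightarrow> (\<lambda>\<omega>. Y \<omega> - Z \<omega>) \<in> H"
  using add_closed[OF _ scale_closed[of Z "-1"], of Y] by simp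

lemma sum_closed: "finite I \<Longrightarrow> I \<noteq> {} \<Longrightarrow> (\<And>i. i \<in> I \<Longrightarrow> Y i \<in> H) \<Longrightarrow> (\<lambda>\<omega>. \<Sum>i\<in>I. Y i \<omega>) \<in> H"
  by (induction I rule: finite_ne_induct) (auto intro: add_closed)

lemma measurable_H [measurable_dest]: "Y \<in> H \<Longrightarrow> Y \<in> borel_measurable M"
  using gaussian by (simp add: gaussian_rv_def)

lemma integrable_mult_H:
  assumes "Y \<in> H" "Z \<in> H" shows "integrable M (\<lambda>\<omega>. Y \<omega> * Z \<omega>)"
proof (rule Bochner_Integration.integrable_bound)
  note assms[measurable]
  show "integrable M (\<lambda>\<omega>. (Y \<omega>)\<^sup>2 + (Z \<omega>)\<^sup>2)"
    using centered_gaussian_rv(1)[OF gaussian centered] assms by auto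
  show "(\<lambda>\<omega>. Y \<omega> * Z \<omega>) \<in> borel_measurable M" by measurable
  have "\<bar>y * z\<bar> \<le> \<bar>y\<^sup>2 + z\<^sup>2\<bar>" for y z :: real
    using sum_squares_bound[of y z] sum_squares_bound[of y "-z"] by (auto simp: abs_if)
  then show "AE \<omega> in M. norm (Y \<omega> * Z \<omega>) \<le> norm ((Y \<omega>)\<^sup>2 + (Z \<omega>)\<^sup>2)" by simp
qed

lemma cov_add_left: "Y \<in> H \<Longrightarrow> Y' \<in> H \<Longrightarrow> Z \<in> H \<Longrightarrow> cov (\<lambda>\<omega>. Y \<omega> + Y' \<omega>) Z = cov Y Z + cov Y' Z"
  by (simp add: distrib_right integrable_mult_H)

lemma cov_scale_left: "cov (\<lambda>\<omega>. a * Y \<omega>) Z = a * cov Y Z"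
  by (simp add: mult.assoc)

lemma cov_commute: "cov Y Z = cov Z Y"
  by (simp add: mult.commute)

lemma cov_sum_left:
  "(\<And>i. i \<in> I \<Longrightarrow> Y i \<in> H) \<Longrightarrow> Z \<in> H \<Longrightarrow> cov (\<lambda>\<omega>. \<Sum>i\<in>I. Y i \<omega>) Z = (\<Sum>i\<in>I. cov (Y i) Z)"
  by (simp add: sum_distrib_right integrable_mult_H)

lemma char_H:
  assumes "Y \<in> H" shows "(CLINT \<omega>|M. iexp (Y \<omega>)) = exp (- cov Y Y / 2)"
  using centered_gaussian_rv(2)[OF gaussian centered] assms by (simp add: power2_eq_square)

lemma distr_std_normal:
  assumes "Y \<in> H" "cov Y Y = 1" shows "distr M borel Y = std_normal_distribution"
proof (rule Levy_uniqueness)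
  note assms(1)[measurable]
  show "real_distribution (distr M borel Y)" by (rule real_distribution_distr) simp
  show "real_distribution std_normal_distribution" by (rule real_dist_normal_dist)
  show "char (distr M borel Y) = char std_normal_distribution"
  proof
    fix t
    have "char (distr M borel Y) t = (CLINT \<omega>|M. iexp (t * Y \<omega>))"
      unfolding char_def by (rule integral_distr) measurable
    also have "\<dots> = exp (- cov (\<lambda>\<omega>. t * Y \<omega>) (\<lambda>\<omega>. t * Y \<omega>) / 2)"
      using char_H[OF scale_closed[OF assms(1)]] by simp
    also have "cov (\<lambda>\<omega>. t * Y \<omega>) (\<lambda>\<omega>. t * Y \<omega>) = t * (t * cov Y Y)"
      unfolding cov_scale_left by (subst cov_commute) (simp add: cov_scale_left)
    also have "exp (- (t * (t * cov Y Y)) / 2) = exp (-(t\<^sup>2) / 2)"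
      by (simp add: assms(2) power2_eq_square)
    finally show "char (distr M borel Y) t = char std_normal_distribution t"
      by (simp add: char_std_normal_distribution)
  qed
qed

lemma cov_square_comb:
  assumes [simp]: "Y \<in> H" "Z \<in> H"
  shows "cov (\<lambda>\<omega>. a * Y \<omega> + b * Z \<omega>) (\<lambda>\<omega>. a * Y \<omega> + b * Z \<omega>) =
    a\<^sup>2 * cov Y Y + 2 * a * b * cov Y Z + b\<^sup>2 * cov Z Z"
proof -
  have "cov (\<lambda>\<omega>. a * Y \<omega> + b * Z \<omega>) (\<lambda>\<omega>. a * Y \<omega> + b * Z \<omega>) =
     expectation (\<lambda>\<omega>. a\<^sup>2 * (Y \<omega> * Y \<omega>) + (2 * a * b) * (Y \<omega> * Z \<omega>) + b\<^sup>2 * (Z \<omega> * Z \<omega>))"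
    by (intro Bochner_Integration.integral_cong) (auto simp: power2_eq_square algebra_simps)
  also have "\<dots> = a\<^sup>2 * cov Y Y + 2 * a * b * cov Y Z + b\<^sup>2 * cov Z Z"
    by (simp add: integrable_mult_H)
  finally show ?thesis .
qed

text \<open>Without the cross term the variance of s Y + t Z is s^2 + t^2, so the joint
  characteristic function is a product.\<close>

lemma uncorrelated_joint_distribution:
  assumes [simp]: "Y \<in> H" "Z \<in> H" and "cov Y Y = 1" "cov Z Z = 1" "cov Y Z = 0"
  shows "distr M (borel \<Otimes>\<^sub>M borel) (\<lambda>\<omega>. (Y \<omega>, Z \<omega>)) = std_normal_distribution \<Otimes>\<^sub>M std_normal_distribution"
proof -
  note assms(1,2)[measurable]
  have "distr M (borel \<Otimes>\<^sub>M borel) (\<lambda>\<omega>. (Y \<omega>, Z \<omega>)) = distr M borel Y \<Otimes>\<^sub>M distr M borel Z"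
  proof (rule joint_distribution_eq_pair_measure)
    fix s t
    have "(CLINT \<omega>|M. iexp (s * Y \<omega> + t * Z \<omega>)) =
      exp (- cov (\<lambda>\<omega>. s * Y \<omega> + t * Z \<omega>) (\<lambda>\<omega>. s * Y \<omega> + t * Z \<omega>) / 2)"
      using char_H[OF add_closed[OF scale_closed scale_closed], of Y Z s t] by simp
    also have "\<dots> = exp (- s\<^sup>2 / 2) * exp (- t\<^sup>2 / 2)"
      by (subst cov_square_comb) (auto simp: assms exp_add[symmetric] field_simps)
    finally show "(CLINT \<omega>|M. iexp (s * Y \<omega> + t * Z \<omega>)) =
      char (distr M borel Y) s * char (distr M borel Z) t"
      by (simp add: distr_std_normal assms char_std_normal_distribution)
  qed measurable
  then show ?thesis by (simp add: distr_std_normal assms)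
qed

end

section \<open>Gaussian windows and the second moment method\<close>

lemma normal_density_ratio_bound:
  fixes v x y \<rho> :: real
  assumes v: "1 \<le> v" and \<rho>: "\<bar>\<rho>\<bar> \<le> 1 / 2" and x: "x \<in> {v<..2 * v}" and y: "y \<in> {v<..2 * v}"
  shows "normal_density (\<rho> * x) (sqrt (1 - \<rho>\<^sup>2)) y \<le> exp (7 * (\<bar>\<rho>\<bar> * v\<^sup>2)) * std_normal_density y"
proof -
  define C where "C = 1 - \<rho>\<^sup>2"
  have \<rho>2: "\<rho>\<^sup>2 \<le> 1/4" "\<rho>\<^sup>2 \<le> \<bar>\<rho>\<bar> / 2"
    using mult_mono[OF \<rho> \<rho>] mult_right_mono[OF \<rho>, of "\<bar>\<rho>\<bar>"] by (auto simp: power2_eq_square)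
  have C: "C \<ge> 3/4" using \<rho>2 by (simp add: C_def)
  have "1 / C \<le> exp (2 * \<bar>\<rho>\<bar>)"
  proof -
    have "1 / C = 1 + \<rho>\<^sup>2 / C" using C by (simp add: C_def field_simps)
    also have "\<rho>\<^sup>2 / C \<le> (\<bar>\<rho>\<bar> / 2) / (1/2)" using C \<rho>2 by (intro frac_le) auto
    also have "(\<bar>\<rho>\<bar> / 2) / (1/2) = \<bar>\<rho>\<bar>" by simp
    also have "1 + \<bar>\<rho>\<bar> \<le> exp (2 * \<bar>\<rho>\<bar>)" using exp_ge_add_one_self[of "2*\<bar>\<rho>\<bar>"] by linarith
    finally show ?thesis by simp
  qed
  then have "sqrt (1 / C) \<le> sqrt (exp (2 * \<bar>\<rho>\<bar>))" by simp
  also have "sqrt (exp (2 * \<bar>\<rho>\<bar>)) = exp \<bar>\<rho>\<bar>"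
    by (rule real_sqrt_unique) (simp_all add: exp_double[symmetric])
  finally have c: "1 / sqrt C \<le> exp \<bar>\<rho>\<bar>" by (simp add: real_sqrt_divide)
  have xy: "0 \<le> x" "0 \<le> y" "x \<le> 2 * v" "y \<le> 2 * v" using x y v by auto
  have "x * y \<le> (2 * v) * (2 * v)" by (rule mult_mono) (use xy in auto)
  then have xy4: "x * y \<le> 4 * v\<^sup>2" by (simp add: power2_eq_square)
  \<comment> \<open>This is the exponent of the quotient of the two densities. Dropping the negative
    squares and using \<open>x * y \<le> 4 * v\<^sup>2\<close> and \<open>C \<ge> 3/4\<close> leaves
    the constant 16 / 3, rounded up to 6; the seventh unit pays for the prefactor
    \<open>1 / sqrt C \<le> exp \<bar>\<rho>\<bar>\<close>, as v is at least 1.\<close>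
  have "- (y - \<rho> * x)\<^sup>2 / (2 * C) + y\<^sup>2 / 2 = (2 * \<rho> * x * y - \<rho>\<^sup>2 * (x\<^sup>2 + y\<^sup>2)) / (2 * C)"
    using C by (simp add: field_simps) (simp add: C_def power2_eq_square algebra_simps)
  also have "\<dots> \<le> (2 * (\<bar>\<rho>\<bar> * (4 * v\<^sup>2))) / (2 * C)"
  proof (intro divide_right_mono)
    have "\<rho> * (x * y) \<le> \<bar>\<rho>\<bar> * (4 * v\<^sup>2)" by (rule mult_mono) (use xy4 xy in auto)
    moreover have "0 \<le> \<rho>\<^sup>2 * (x\<^sup>2 + y\<^sup>2)" by simp
    ultimately show "2 * \<rho> * x * y - \<rho>\<^sup>2 * (x\<^sup>2 + y\<^sup>2) \<le> 2 * (\<bar>\<rho>\<bar> * (4 * v\<^sup>2))"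
      unfolding mult.assoc by linarith
  qed (use C in simp)
  also have "\<dots> = (4 * (\<bar>\<rho>\<bar> * v\<^sup>2)) / C" using C by (simp add: field_simps)
  also have "\<dots> \<le> (4 * (\<bar>\<rho>\<bar> * v\<^sup>2)) / (3 / 4)" by (rule divide_left_mono) (use C in auto)
  also have "\<dots> \<le> 6 * (\<bar>\<rho>\<bar> * v\<^sup>2)" by simp
  finally have e: "- (y - \<rho> * x)\<^sup>2 / (2 * C) \<le> 6 * (\<bar>\<rho>\<bar> * v\<^sup>2) + - y\<^sup>2 / 2" by simp
  have "normal_density (\<rho> * x) (sqrt C) y = 1 / sqrt C * (1 / sqrt (2 * pi) * exp (- (y - \<rho> * x)\<^sup>2 / (2 * C)))"
    using C by (simp add: normal_density_def real_sqrt_mult field_simps)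
  also have "\<dots> \<le> exp \<bar>\<rho>\<bar> * (1 / sqrt (2 * pi) * exp (6 * (\<bar>\<rho>\<bar> * v\<^sup>2) + - y\<^sup>2 / 2))"
    using c e C by (intro mult_mono) auto
  also have "\<dots> = exp (\<bar>\<rho>\<bar> + 6 * (\<bar>\<rho>\<bar> * v\<^sup>2)) * std_normal_density y"
    unfolding std_normal_density_def exp_add by simp
  also have "\<dots> \<le> exp (7 * (\<bar>\<rho>\<bar> * v\<^sup>2)) * std_normal_density y"
  proof (intro mult_right_mono)
    have "\<bar>\<rho>\<bar> * 1 \<le> \<bar>\<rho>\<bar> * v\<^sup>2" using v by (intro mult_left_mono) auto
    then show "exp (\<bar>\<rho>\<bar> + 6 * (\<bar>\<rho>\<bar> * v\<^sup>2)) \<le> exp (7 * (\<bar>\<rho>\<bar> * v\<^sup>2))" by simp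
  qed simp
  finally show ?thesis by (simp add: C_def)
qed

text \<open>Exceedances are counted only up to 2 v. The product of two such values is at most 4 v^2,
  which limits the effect of a correlation, whereas over the whole quadrant above v the density
  ratio may be unbounded. Counting fewer exceedances is safe when the probability of having none is
  bounded from above.\<close>

definition window :: "real \<Rightarrow> real" where
  "window v = measure std_normal_distribution {v<..2 * v}"

text \<open>The interval from v to v + 1 lies in the window and carries at least the density at v +
  1. The loss is a factor exp (O(v)), negligible against an exponential surplus in v^2.\<close>

lemma window_lower_bound:
  assumes "1 \<le> v" shows "exp (- (v + 1)\<^sup>2 / 2) / sqrt (2 * pi) \<le> window v"
proof -
  interpret N: real_distribution std_normal_distribution by (rule real_dist_normal_dist)
  let ?c = "exp (- (v + 1)\<^sup>2 / 2) / sqrt (2 * pi)"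
  have "ennreal ?c = ennreal ?c * emeasure lborel {v<..v+1}" by simp
  also have "\<dots> = (\<integral>\<^sup>+x. ennreal ?c * indicator {v<..v+1} x \<partial>lborel)"
    by (simp add: nn_integral_cmult_indicator)
  also have "\<dots> \<le> (\<integral>\<^sup>+x. ennreal (std_normal_density x) * indicator {v<..2 * v} x \<partial>lborel)"
  proof (rule nn_integral_mono)
    fix x
    show "ennreal ?c * indicator {v<..v+1} x \<le> ennreal (std_normal_density x) * indicator {v<..2 * v} x"
    proof (cases "x \<in> {v<..v+1}")
      case True
      then have "x\<^sup>2 \<le> (v+1)\<^sup>2" using assms by (intro power_mono) auto
      with True assms show ?thesis
        by (auto simp: std_normal_density_def divide_right_mono intro!: ennreal_leI)
    qed simp
  qed
  also have "\<dots> = emeasure std_normal_distribution {v<..2 * v}" by (simp add: emeasure_density)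
  also have "\<dots> = ennreal (window v)" by (simp add: window_def N.emeasure_eq_measure)
  finally show ?thesis by (simp add: window_def)
qed

lemma window_pos: "1 \<le> v \<Longrightarrow> 0 < window v"
  by (rule less_le_trans[OF _ window_lower_bound]) auto

text \<open>Chebyshev's inequality for the count S with mean m: if no event occurs, then (S - m)^2 =
  m^2.\<close>

lemma (in prob_space) second_moment_method:
  fixes q :: real
  assumes "finite P" and A: "\<And>p. p \<in> P \<Longrightarrow> A p \<in> events" "\<And>p. p \<in> P \<Longrightarrow> prob (A p) = q"
    and pos: "P \<noteq> {}" "0 < q"
  shows "prob {\<omega>\<in>space M. \<forall>p\<in>P. \<omega> \<notin> A p} \<le>
    (\<Sum>p\<in>P. \<Sum>p'\<in>P. prob (A p \<inter> A p')) / (card P * q)\<^sup>2 - 1"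
proof -
  define S where "S \<omega> = (\<Sum>p\<in>P. indicator (A p) \<omega> :: real)" for \<omega>
  define m where "m = card P * q"
  have m: "m > 0" using pos assms(1) by (simp add: m_def card_gt_0_iff)
  let ?N = "{\<omega>\<in>space M. \<forall>p\<in>P. \<omega> \<notin> A p}"
  have "?N = space M - (\<Union>p\<in>P. A p)" by auto
  then have N: "?N \<in> events" using A assms(1) by (auto intro!: sets.Diff sets.finite_UN)
  have Sq: "(S \<omega>)\<^sup>2 = (\<Sum>p\<in>P. \<Sum>p'\<in>P. indicator (A p \<inter> A p') \<omega>)" for \<omega>
    by (simp add: S_def power2_eq_square sum_product indicator_inter_arith)
  have iind: "integrable M (indicat_real B)" if "B \<in> events" for B
    using that by (auto intro!: integrable_real_indicator simp: emeasure_eq_measure)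
  have iS: "integrable M S" unfolding S_def using A iind by auto
  have iS2: "integrable M (\<lambda>\<omega>. (S \<omega>)\<^sup>2)" unfolding Sq using A iind by auto
  have ES: "expectation S = m" unfolding S_def using A iind by (simp add: m_def)
  have ES2: "expectation (\<lambda>\<omega>. (S \<omega>)\<^sup>2) = (\<Sum>p\<in>P. \<Sum>p'\<in>P. prob (A p \<inter> A p'))"
    unfolding Sq using A iind by simp
  have "m\<^sup>2 * prob ?N = expectation (\<lambda>\<omega>. m\<^sup>2 * indicator ?N \<omega>)"
    using N by simp
  also have "\<dots> \<le> expectation (\<lambda>\<omega>. (S \<omega>)\<^sup>2 - 2 * m * S \<omega> + m\<^sup>2)"
  proof (rule integral_mono)
    show "integrable M (\<lambda>\<omega>. m\<^sup>2 * indicator ?N \<omega>)" using iind[OF N] by simp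
    show "integrable M (\<lambda>\<omega>. (S \<omega>)\<^sup>2 - 2 * m * S \<omega> + m\<^sup>2)" using iS iS2 by simp
    fix \<omega>
    have "(S \<omega>)\<^sup>2 - 2 * m * S \<omega> + m\<^sup>2 = (S \<omega> - m)\<^sup>2" by (simp add: power2_diff)
    moreover have "S \<omega> = 0" if "\<omega> \<in> ?N" using that by (simp add: S_def)
    ultimately show "m\<^sup>2 * indicator ?N \<omega> \<le> (S \<omega>)\<^sup>2 - 2 * m * S \<omega> + m\<^sup>2"
      by (auto simp: indicator_def)
  qed
  also have "\<dots> = expectation (\<lambda>\<omega>. (S \<omega>)\<^sup>2) - m\<^sup>2"
    using iS iS2 by (simp add: ES prob_space power2_eq_square)
  finally have "m\<^sup>2 * prob ?N \<le> (\<Sum>p\<in>P. \<Sum>p'\<in>P. prob (A p \<inter> A p')) - m\<^sup>2" by (simp add: ES2)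
  then have "prob ?N \<le> ((\<Sum>p\<in>P. \<Sum>p'\<in>P. prob (A p \<inter> A p')) - m\<^sup>2) / m\<^sup>2"
    using m by (simp add: pos_le_divide_eq mult.commute)
  also have "\<dots> = (\<Sum>p\<in>P. \<Sum>p'\<in>P. prob (A p \<inter> A p')) / m\<^sup>2 - 1" using m by (simp add: diff_divide_distrib)
  finally show ?thesis by (simp add: m_def)
qed

section \<open>Exceedance counts for weakly correlated families\<close>

context gaussian_space
begin

text \<open>Regression of Z on Y: Z = \<rho> Y + c V with V independent of Y. Given Y = x, the
  variable Z is thus normal with mean \<rho> x and standard deviation c, and its density is compared
  pointwise on the window with the standard one.\<close>

lemma joint_window_bound:
  assumes [simp]: "Y \<in> H" "Z \<in> H" and "cov Y Y = 1" "cov Z Z = 1"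
    and v: "1 \<le> v" and \<rho>: "\<bar>cov Y Z\<bar> \<le> 1 / 2"
  shows "prob {\<omega>\<in>space M. Y \<omega> \<in> {v<..2 * v} \<and> Z \<omega> \<in> {v<..2 * v}}
    \<le> exp (7 * (\<bar>cov Y Z\<bar> * v\<^sup>2)) * (window v)\<^sup>2"
proof -
  note assms(1,2)[measurable]
  define \<rho> where "\<rho> = cov Y Z"
  define W where "W = {v<..2 * v}"
  define C where "C = exp (7 * (\<bar>\<rho>\<bar> * v\<^sup>2))"
  have [measurable]: "W \<in> sets borel" by (simp add: W_def)
  have "\<rho>\<^sup>2 \<le> 1/4" using mult_mono[OF \<rho> \<rho>] by (auto simp: power2_eq_square \<rho>_def)
  define c where "c = sqrt (1 - \<rho>\<^sup>2)"
  have c: "c > 0" "c\<^sup>2 = 1 - \<rho>\<^sup>2" using \<open>\<rho>\<^sup>2 \<le> 1/4\<close> by (auto simp: c_def)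
  define V where "V = (\<lambda>\<omega>. (- \<rho> / c) * Y \<omega> + (1 / c) * Z \<omega>)"
  have V [simp]: "V \<in> H" unfolding V_def by (intro add_closed scale_closed) auto
  note V[measurable]
  have "cov V V = (- \<rho> / c)\<^sup>2 + 2 * (- \<rho> / c) * (1 / c) * \<rho> + (1 / c)\<^sup>2"
    unfolding V_def by (subst cov_square_comb) (auto simp: assms \<rho>_def)
  also have "\<dots> = (1 - \<rho>\<^sup>2) / c\<^sup>2" using c by (simp add: power2_eq_square field_simps)
  finally have VV: "cov V V = 1" using c \<open>\<rho>\<^sup>2 \<le> 1/4\<close> by (simp split: if_splits)
  have "cov V Y = (- \<rho> / c) * cov Y Y + (1 / c) * cov Z Y"
    unfolding V_def by (subst cov_add_left[OF scale_closed scale_closed]) (simp_all only: assms cov_scale_left)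
  then have YV: "cov Y V = 0" using cov_commute[of V Y] cov_commute[of Z Y] by (simp add: assms \<rho>_def)
  have Z: "Z \<omega> = \<rho> * Y \<omega> + c * V \<omega>" for \<omega> using c by (simp add: V_def field_simps)
  interpret N: real_distribution std_normal_distribution by (rule real_dist_normal_dist)
  let ?N = std_normal_distribution
  let ?S = "{(x, w). x \<in> W \<and> \<rho> * x + c * w \<in> W}"
  have "{z \<in> space (borel \<Otimes>\<^sub>M borel). fst z \<in> W \<and> \<rho> * fst z + c * snd z \<in> W} \<in> sets (borel \<Otimes>\<^sub>M borel)"
    by measurable
  also have "{z \<in> space (borel \<Otimes>\<^sub>M borel). fst z \<in> W \<and> \<rho> * fst z + c * snd z \<in> W} = ?S"
    by (auto simp: space_pair_measure)
  finally have S [measurable]: "?S \<in> sets (borel \<Otimes>\<^sub>M borel)" .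
  have inner: "emeasure ?N (Pair x -` ?S) \<le> ennreal (C * window v) * indicator W x" for x
  proof (cases "x \<in> W")
    case True
    have "emeasure ?N (Pair x -` ?S) = (\<integral>\<^sup>+w. ennreal (std_normal_density w) * indicator (Pair x -` ?S) w \<partial>lborel)"
      using sets_Pair1[OF S, of x] by (simp add: emeasure_density)
    \<comment> \<open>The integrand is rewritten in terms of y = \<rho> x + c w, ready for this
      affine substitution.\<close>
    also have "\<dots> = (\<integral>\<^sup>+w. ennreal \<bar>c\<bar> * (ennreal (normal_density (\<rho> * x) c (\<rho> * x + c * w)) * indicator W (\<rho> * x + c * w)) \<partial>lborel)"
    proof (intro nn_integral_cong)
      fix w
      have "std_normal_density w = c * normal_density (\<rho> * x) c (\<rho> * x + c * w)"
        using c(1) by (simp add: normal_density_def real_sqrt_mult power_mult_distrib)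
      then show "ennreal (std_normal_density w) * indicator (Pair x -` ?S) w =
        ennreal \<bar>c\<bar> * (ennreal (normal_density (\<rho> * x) c (\<rho> * x + c * w)) * indicator W (\<rho> * x + c * w))"
        using True c by (auto simp: indicator_def ennreal_mult)
    qed
    also have "\<dots> = ennreal \<bar>c\<bar> * (\<integral>\<^sup>+w. ennreal (normal_density (\<rho> * x) c (\<rho> * x + c * w)) * indicator W (\<rho> * x + c * w) \<partial>lborel)"
      by (rule nn_integral_cmult) simp
    also have "\<dots> = (\<integral>\<^sup>+y. ennreal (normal_density (\<rho> * x) c y) * indicator W y \<partial>lborel)"
      by (rule nn_integral_real_affine[symmetric]) (use c in auto)
    also have "\<dots> \<le> (\<integral>\<^sup>+y. ennreal C * (ennreal (std_normal_density y) * indicator W y) \<partial>lborel)"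
    proof (rule nn_integral_mono)
      fix y
      show "ennreal (normal_density (\<rho> * x) c y) * indicator W y \<le> ennreal C * (ennreal (std_normal_density y) * indicator W y)"
      proof (cases "y \<in> W")
        assume "y \<in> W"
        then have "normal_density (\<rho> * x) c y \<le> C * std_normal_density y"
          using normal_density_ratio_bound[OF v, of \<rho> x y] True \<rho> by (simp add: C_def c_def W_def \<rho>_def)
        then show ?thesis using \<open>y \<in> W\<close> by (simp add: ennreal_mult[symmetric] C_def ennreal_leI)
      qed simp
    qed
    also have "\<dots> = ennreal C * emeasure ?N W"
      by (subst nn_integral_cmult) (auto simp: emeasure_density)
    also have "\<dots> = ennreal (C * window v)"
      by (simp add: N.emeasure_eq_measure window_def W_def ennreal_mult C_def)
    finally show ?thesis using True by simp
  qed auto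
  have "emeasure M {\<omega>\<in>space M. Y \<omega> \<in> W \<and> Z \<omega> \<in> W} = emeasure (distr M (borel \<Otimes>\<^sub>M borel) (\<lambda>\<omega>. (Y \<omega>, V \<omega>))) ?S"
    by (subst emeasure_distr) (auto simp: Z intro!: arg_cong[where f="emeasure M"])
  also have "\<dots> = emeasure (?N \<Otimes>\<^sub>M ?N) ?S"
    by (subst uncorrelated_joint_distribution) (auto simp: assms VV YV)
  also have "\<dots> = (\<integral>\<^sup>+x. emeasure ?N (Pair x -` ?S) \<partial>?N)"
    by (rule N.emeasure_pair_measure_alt) (use S in \<open>simp cong: sets_pair_measure_cong\<close>)
  also have "\<dots> \<le> (\<integral>\<^sup>+x. ennreal (C * window v) * indicator W x \<partial>?N)"
    by (intro nn_integral_mono inner)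
  also have "\<dots> = ennreal (C * window v) * emeasure ?N W"
    by (rule nn_integral_cmult_indicator) simp
  also have "\<dots> = ennreal (C * (window v)\<^sup>2)"
    by (simp add: N.emeasure_eq_measure window_def W_def ennreal_mult C_def power2_eq_square mult.assoc)
  finally show ?thesis unfolding W_def \<rho>_def[symmetric] C_def[symmetric]
    by (simp add: emeasure_eq_measure C_def)
qed

text \<open>\<open>B\<close> collects the pairs for which only the crude bound K is available and
  may fill at most a fraction \<delta> of each row. In the normalised second moment the diagonal
  contributes the first term, the pairs outside \<open>B\<close> give exp (7 \<epsilon>), from which
  the squared mean removes 1, and the pairs in \<open>B\<close> give the last term.\<close>

lemma prob_below_bound:
  fixes Z :: "'p \<Rightarrow> 'w \<Rightarrow> real" and v K \<epsilon> \<delta> :: real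
  assumes P: "finite P" "P \<noteq> {}" and v: "1 \<le> v"
    and H: "\<And>p. p \<in> P \<Longrightarrow> Z p \<in> H" and var: "\<And>p. p \<in> P \<Longrightarrow> cov (Z p) (Z p) = 1"
    and half: "\<And>p p'. p \<in> P \<Longrightarrow> p' \<in> P \<Longrightarrow> p \<noteq> p' \<Longrightarrow> \<bar>cov (Z p) (Z p')\<bar> \<le> 1 / 2"
    and K: "\<And>p p'. p \<in> P \<Longrightarrow> p' \<in> P \<Longrightarrow> p \<noteq> p' \<Longrightarrow> \<bar>cov (Z p) (Z p')\<bar> * v\<^sup>2 \<le> K"
    and \<epsilon>: "\<And>p p'. p \<in> P \<Longrightarrow> p' \<in> P \<Longrightarrow> p \<noteq> p' \<Longrightarrow> (p, p') \<notin> B \<Longrightarrow> \<bar>cov (Z p) (Z p')\<bar> * v\<^sup>2 \<le> \<epsilon>"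
    and B: "\<And>p. p \<in> P \<Longrightarrow> real (card {p'\<in>P. (p, p') \<in> B}) \<le> \<delta> * card P"
  shows "prob {\<omega>\<in>space M. \<forall>p\<in>P. Z p \<omega> \<le> v} \<le>
    1 / (card P * window v) + (exp (7 * \<epsilon>) - 1) + \<delta> * exp (7 * K)"
proof -
  note H[measurable]
  define A where "A p = {\<omega>\<in>space M. Z p \<omega> \<in> {v<..2 * v}}" for p
  have A: "A p \<in> events" if "p \<in> P" for p using that unfolding A_def by measurable
  define q where "q = window v"
  have q: "q > 0" using window_pos[OF v] by (simp add: q_def)
  have prob: "prob (A p) = q" if "p \<in> P" for p
  proof -
    have [measurable]: "Z p \<in> borel_measurable M" using H[OF that] by measurable
    have "q = measure (distr M borel (Z p)) {v<..2 * v}"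
      by (simp add: q_def window_def distr_std_normal H var that)
    also have "\<dots> = prob (A p)"
      by (subst measure_distr) (auto simp: A_def intro!: arg_cong[where f=prob])
    finally show ?thesis by simp
  qed
  have "prob {\<omega>\<in>space M. \<forall>p\<in>P. Z p \<omega> \<le> v} \<le> prob {\<omega>\<in>space M. \<forall>p\<in>P. \<omega> \<notin> A p}"
  proof (rule finite_measure_mono)
    have "{\<omega>\<in>space M. \<forall>p\<in>P. \<omega> \<notin> A p} = space M - (\<Union>p\<in>P. A p)" by auto
    then show "{\<omega>\<in>space M. \<forall>p\<in>P. \<omega> \<notin> A p} \<in> events"
      using A P by (auto intro!: sets.Diff sets.finite_UN)
  qed (auto simp: A_def)
  also have "\<dots> \<le> (\<Sum>p\<in>P. \<Sum>p'\<in>P. prob (A p \<inter> A p')) / (card P * q)\<^sup>2 - 1"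
    by (rule second_moment_method) (use P A prob q in auto)
  also have "(\<Sum>p\<in>P. \<Sum>p'\<in>P. prob (A p \<inter> A p')) \<le> (\<Sum>p\<in>P. q + exp (7 * \<epsilon>) * q\<^sup>2 * card P + exp (7 * K) * q\<^sup>2 * (\<delta> * card P))"
  proof (rule sum_mono)
    fix p assume p: "p \<in> P"
    \<comment> \<open>Diagonal, ordinary and exceptional pairs are covered by one sum of three
      nonnegative terms; their overlap only enlarges the bound.\<close>
    have "(\<Sum>p'\<in>P. prob (A p \<inter> A p')) \<le> (\<Sum>p'\<in>P. (if p' = p then q else 0) + exp (7 * \<epsilon>) * q\<^sup>2 +
        exp (7 * K) * q\<^sup>2 * indicator {p'\<in>P. (p, p') \<in> B} p')"
    proof (rule sum_mono)
      fix p' assume p': "p' \<in> P"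
      show "prob (A p \<inter> A p') \<le> (if p' = p then q else 0) + exp (7 * \<epsilon>) * q\<^sup>2 +
        exp (7 * K) * q\<^sup>2 * indicator {p'\<in>P. (p, p') \<in> B} p'"
      proof (cases "p' = p")
        case True
        then show ?thesis using prob[OF p] by simp
      next
        case False
        have "A p \<inter> A p' = {\<omega>\<in>space M. Z p \<omega> \<in> {v<..2 * v} \<and> Z p' \<omega> \<in> {v<..2 * v}}" by (auto simp: A_def)
        then have *: "prob (A p \<inter> A p') \<le> exp (7 * (\<bar>cov (Z p) (Z p')\<bar> * v\<^sup>2)) * q\<^sup>2"
          using joint_window_bound[OF H[OF p] H[OF p'] var[OF p] var[OF p'] v half[OF p p']] False
          by (simp add: q_def)
        show ?thesis
        proof (cases "(p, p') \<in> B")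
          case True
          have "exp (7 * (\<bar>cov (Z p) (Z p')\<bar> * v\<^sup>2)) * q\<^sup>2 \<le> exp (7 * K) * q\<^sup>2"
            using K[OF p p'] False by (intro mult_right_mono) auto
          also have "\<dots> \<le> exp (7 * \<epsilon>) * q\<^sup>2 + exp (7 * K) * q\<^sup>2" by simp
          finally show ?thesis using * True False p' by simp
        next
          case nB: False
          have "exp (7 * (\<bar>cov (Z p) (Z p')\<bar> * v\<^sup>2)) * q\<^sup>2 \<le> exp (7 * \<epsilon>) * q\<^sup>2"
            using \<epsilon>[OF p p'] False nB by (intro mult_right_mono) auto
          then show ?thesis using * nB False by simp
        qed
      qed
    qed
    also have "\<dots> = q + exp (7 * \<epsilon>) * q\<^sup>2 * card P + exp (7 * K) * q\<^sup>2 * card {p'\<in>P. (p, p') \<in> B}"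
    proof -
      have "(\<Sum>p'\<in>P. indicat_real {p'\<in>P. (p, p') \<in> B} p') = (\<Sum>p'\<in>{p'\<in>P. (p, p') \<in> B}. 1)"
        by (rule sum.mono_neutral_cong_right) (use P in auto)
      then show ?thesis using P p by (simp add: sum.distrib sum_distrib_left[symmetric] sum.delta)
    qed
    also have "\<dots> \<le> q + exp (7 * \<epsilon>) * q\<^sup>2 * card P + exp (7 * K) * q\<^sup>2 * (\<delta> * card P)"
      using B[OF p] by (intro add_left_mono mult_left_mono) auto
    finally show "(\<Sum>p'\<in>P. prob (A p \<inter> A p')) \<le> q + exp (7 * \<epsilon>) * q\<^sup>2 * card P + exp (7 * K) * q\<^sup>2 * (\<delta> * card P)" .
  qed
  also have "(\<Sum>p\<in>P. q + exp (7 * \<epsilon>) * q\<^sup>2 * card P + exp (7 * K) * q\<^sup>2 * (\<delta> * card P)) / (card P * q)\<^sup>2 - 1 =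
     1 / (card P * q) + (exp (7 * \<epsilon>) - 1) + \<delta> * exp (7 * K)"
    using q P by (simp add: field_simps power2_eq_square)
  finally show ?thesis by (simp add: q_def divide_right_mono)
qed

end

section \<open>Families with a nearly constant correlation\<close>

lemma abs_mean_diff_le:
  fixes f :: "'i \<Rightarrow> real"
  assumes Q: "finite Q" "Q \<noteq> {}" and f: "\<And>j. j \<in> Q \<Longrightarrow> \<bar>f j - l\<bar> \<le> g j"
  shows "\<bar>1 / card Q * (\<Sum>j\<in>Q. f j) - l\<bar> \<le> 1 / card Q * (\<Sum>j\<in>Q. g j)"
proof -
  have n: "real (card Q) > 0" using Q by (simp add: card_gt_0_iff)
  have "1 / card Q * (\<Sum>j\<in>Q. f j) - l = 1 / card Q * (\<Sum>j\<in>Q. f j - l)"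
    using n by (simp add: sum_subtractf field_simps)
  also have "\<bar>\<dots>\<bar> = 1 / card Q * \<bar>\<Sum>j\<in>Q. f j - l\<bar>" by (simp add: abs_mult)
  also have "\<bar>\<Sum>j\<in>Q. f j - l\<bar> \<le> (\<Sum>j\<in>Q. \<bar>f j - l\<bar>)" by (rule sum_abs)
  also have "\<dots> \<le> (\<Sum>j\<in>Q. g j)" by (rule sum_mono) (rule f)
  finally show ?thesis using n by (simp add: divide_right_mono)
qed

context gaussian_space
begin

lemma cov_diff_diff:
  assumes "A \<in> H" "B \<in> H" "W \<in> H"
  shows "cov (\<lambda>\<omega>. A \<omega> - W \<omega>) (\<lambda>\<omega>. B \<omega> - W \<omega>) = cov A B - cov A W - cov B W + cov W W"
proof -
  have "cov (\<lambda>\<omega>. A \<omega> - W \<omega>) (\<lambda>\<omega>. B \<omega> - W \<omega>) =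
    expectation (\<lambda>\<omega>. A \<omega> * B \<omega> - A \<omega> * W \<omega> - B \<omega> * W \<omega> + W \<omega> * W \<omega>)"
    by (intro Bochner_Integration.integral_cong) (auto simp: algebra_simps)
  also have "\<dots> = cov A B - cov A W - cov B W + cov W W"
    using assms by (simp add: integrable_mult_H)
  finally show ?thesis .
qed

lemma prob_lower_tail:
  assumes "W \<in> H" "0 < a"
  shows "prob {\<omega>\<in>space M. W \<omega> < - a} \<le> cov W W / a\<^sup>2"
proof -
  note assms(1)[measurable]
  have "prob {\<omega>\<in>space M. W \<omega> < - a} \<le> prob {\<omega>\<in>space M. a\<^sup>2 \<le> W \<omega> * W \<omega>}"
  proof (rule finite_measure_mono)
    show "{\<omega>\<in>space M. W \<omega> < - a} \<subseteq> {\<omega>\<in>space M. a\<^sup>2 \<le> W \<omega> * W \<omega>}"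
    proof safe
      fix \<omega> assume "W \<omega> < - a"
      then have "a * a \<le> (- W \<omega>) * (- W \<omega>)" using assms(2) by (intro mult_mono) auto
      then show "a\<^sup>2 \<le> W \<omega> * W \<omega>" by (simp add: power2_eq_square)
    qed
  qed measurable
  also have "\<dots> \<le> cov W W / a\<^sup>2"
    by (rule integral_Markov_inequality_measure[where A="{}"]) (use assms in \<open>auto simp: integrable_mult_H\<close>)
  finally show ?thesis .
qed

text \<open>Subtracting the average of the \<open>Y j\<close> removes the common part \<open>l\<close> of the correlations.\<close>

lemma prob_max_le_bound:
  fixes X :: "'p \<Rightarrow> 'w \<Rightarrow> real" and Y :: "'q \<Rightarrow> 'w \<Rightarrow> real" and e l k \<delta> \<eta> u v :: real
  assumes P: "finite P" "P \<noteq> {}" and Q: "finite Q" "Q \<noteq> {}" "1 \<le> e * card Q"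
    and X: "\<And>p. p \<in> P \<Longrightarrow> X p \<in> H" "\<And>p. p \<in> P \<Longrightarrow> cov (X p) (X p) = 1"
    and Y: "\<And>j. j \<in> Q \<Longrightarrow> Y j \<in> H" "\<And>j. j \<in> Q \<Longrightarrow> cov (Y j) (Y j) = 1"
    and XY: "\<And>p j. p \<in> P \<Longrightarrow> j \<in> Q \<Longrightarrow> \<bar>cov (X p) (Y j) - l\<bar> \<le> e"
    and YY: "\<And>j j'. j \<in> Q \<Longrightarrow> j' \<in> Q \<Longrightarrow> j \<noteq> j' \<Longrightarrow> \<bar>cov (Y j) (Y j') - l\<bar> \<le> e"
    and k: "\<And>p p'. p \<in> P \<Longrightarrow> p' \<in> P \<Longrightarrow> p \<noteq> p' \<Longrightarrow> \<bar>cov (X p) (X p')\<bar> \<le> k"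
    and XX: "\<And>p p'. p \<in> P \<Longrightarrow> p' \<in> P \<Longrightarrow> p \<noteq> p' \<Longrightarrow> (p, p') \<notin> B \<Longrightarrow> \<bar>cov (X p) (X p') - l\<bar> \<le> e"
    and B: "\<And>p. p \<in> P \<Longrightarrow> real (card {p'\<in>P. (p, p') \<in> B}) \<le> \<delta> * card P"
    and l: "0 \<le> l" "0 \<le> e" "0 \<le> k" "k + l + 4 * e \<le> 1 / 4"
    and \<eta>: "0 < \<eta>" "0 < u" "1 \<le> v" "(1 + \<eta>) * u \<le> v * sqrt (1 - (l + 4 * e))"
  shows "prob {\<omega>\<in>space M. \<forall>p\<in>P. X p \<omega> \<le> u} \<le>
    (l + 2 * e) / (\<eta> * u)\<^sup>2 + 1 / (card P * window v) + (exp (7 * (10 * e * v\<^sup>2)) - 1)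
      + \<delta> * exp (7 * (2 * (k + l + 4 * e) * v\<^sup>2))"
proof -
  define n where "n = real (card Q)"
  have n: "n > 0" using Q by (simp add: n_def card_gt_0_iff)
  have ne: "1 / n \<le> e" using n Q(3) by (simp add: n_def field_simps)
  define W where "W = (\<lambda>\<omega>. (1 / n) * (\<Sum>j\<in>Q. Y j \<omega>))"
  have W: "W \<in> H" unfolding W_def by (intro scale_closed sum_closed Q Y)
  have covW: "cov Z W = 1 / n * (\<Sum>j\<in>Q. cov Z (Y j))" if "Z \<in> H" for Z
  proof -
    have "cov Z W = cov W Z" by (rule cov_commute)
    also have "\<dots> = 1 / n * (\<Sum>j\<in>Q. cov (Y j) Z)"
      unfolding W_def cov_scale_left using that Y Q by (subst cov_sum_left) auto
    finally show ?thesis by (simp add: cov_commute[of Z])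
  qed
  have XW: "\<bar>cov (X p) W - l\<bar> \<le> e" if "p \<in> P" for p
    using abs_mean_diff_le[OF Q(1,2), of "\<lambda>j. cov (X p) (Y j)" l "\<lambda>_. e"] XY[OF that] n
    by (simp add: covW X that n_def)
  \<comment> \<open>One of the averaged variables is \<open>Y j\<close> itself, whose covariance is
    1 instead of about l. This entry costs 1 / n, which is at most e by the lower bound on the size
    of Q.\<close>
  have YW: "\<bar>cov (Y j) W - l\<bar> \<le> 2 * e" if "j \<in> Q" for j
  proof -
    have "\<bar>cov (Y j) W - l\<bar> \<le> 1 / n * (\<Sum>j'\<in>Q. e + (if j' = j then 1 else 0))"
      unfolding covW[OF Y(1)[OF that]] n_def
    proof (rule abs_mean_diff_le[OF Q(1,2)])
      fix j' assume j': "j' \<in> Q"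
      show "\<bar>cov (Y j) (Y j') - l\<bar> \<le> e + (if j' = j then 1 else 0)"
        using YY[OF that j'] Y(2)[OF that] l by (cases "j = j'") auto
    qed
    also have "\<dots> = e + 1 / n" using n Q that by (simp add: sum.distrib n_def field_simps)
    finally show ?thesis using ne by simp
  qed
  have WW: "\<bar>cov W W - l\<bar> \<le> 2 * e"
    using abs_mean_diff_le[OF Q(1,2), of "\<lambda>j. cov (Y j) W" l "\<lambda>_. 2 * e"] YW n
    unfolding covW[OF W] by (simp add: cov_commute[of W] n_def)
  \<comment> \<open>In the covariance of two such differences the four copies of l cancel; for pairs
    outside \<open>B\<close> only the errors e + e + e + 2 e remain.\<close>
  define U where "U p = (\<lambda>\<omega>. X p \<omega> - W \<omega>)" for p
  have U: "U p \<in> H" if "p \<in> P" for p unfolding U_def using X W that by (intro diff_closed)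
  have covU: "cov (U p) (U p') = cov (X p) (X p') - cov (X p) W - cov (X p') W + cov W W"
    if "p \<in> P" "p' \<in> P" for p p'
    unfolding U_def using that X W by (intro cov_diff_diff) auto
  \<comment> \<open>The lower bound for the variance of \<open>U p\<close> is 1 - 2 (l + e) + (l - 2
    e).\<close>
  define \<tau> where "\<tau> = l + 4 * e"
  have \<tau>: "0 \<le> \<tau>" "\<tau> \<le> 1 / 4" using l by (auto simp: \<tau>_def)
  define \<sigma> where "\<sigma> p = sqrt (cov (U p) (U p))" for p
  have UU: "1 - \<tau> \<le> cov (U p) (U p)" if "p \<in> P" for p
    using covU[OF that that] XW[OF that] WW X(2)[OF that] unfolding \<tau>_def by linarith
  have \<sigma>: "sqrt (1 - \<tau>) \<le> \<sigma> p" "0 < \<sigma> p" "(\<sigma> p)\<^sup>2 = cov (U p) (U p)" "1 / 2 \<le> (\<sigma> p)\<^sup>2" if "p \<in> P" for p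
    using UU[OF that] \<tau> by (auto simp: \<sigma>_def)
  define Z where "Z p = (\<lambda>\<omega>. (1 / \<sigma> p) * U p \<omega>)" for p
  have covZ: "cov (Z p) (Z p') = cov (U p) (U p') / (\<sigma> p * \<sigma> p')" for p p'
  proof -
    have "cov (Z p) (Z p') = 1 / \<sigma> p * cov (U p) (Z p')" unfolding Z_def by (rule cov_scale_left)
    also have "cov (U p) (Z p') = cov (Z p') (U p)" by (rule cov_commute)
    also have "\<dots> = 1 / \<sigma> p' * cov (U p') (U p)" unfolding Z_def by (rule cov_scale_left)
    finally show ?thesis by (simp add: cov_commute[of "U p"])
  qed
  \<comment> \<open>The variances of the differences are at least 1 / 2, so normalising at most
    doubles a covariance.\<close>
  have covZ_le: "\<bar>cov (Z p) (Z p')\<bar> \<le> 2 * \<bar>cov (U p) (U p')\<bar>" if "p \<in> P" "p' \<in> P" for p p'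
  proof -
    have "sqrt (1/2) \<le> \<sigma> p" "sqrt (1/2) \<le> \<sigma> p'"
      using \<sigma>(4)[OF that(1)] \<sigma>(4)[OF that(2)] \<sigma>(2)[OF that(1)] \<sigma>(2)[OF that(2)]
      by (auto intro!: real_le_lsqrt)
    then have "sqrt (1/2) * sqrt (1/2) \<le> \<sigma> p * \<sigma> p'" by (intro mult_mono) (use \<sigma>(2) that in \<open>auto intro: less_imp_le\<close>)
    then have "1 / 2 \<le> \<sigma> p * \<sigma> p'" by simp
    then have "\<bar>cov (U p) (U p')\<bar> / (\<sigma> p * \<sigma> p') \<le> \<bar>cov (U p) (U p')\<bar> / (1 / 2)"
      by (intro divide_left_mono) auto
    then show ?thesis using \<sigma>(2)[OF that(1)] \<sigma>(2)[OF that(2)] by (simp add: covZ abs_mult)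
  qed
  have offdiag: "\<bar>cov (Z p) (Z p')\<bar> \<le> 2 * (k + l + 4 * e)" if "p \<in> P" "p' \<in> P" "p \<noteq> p'" for p p'
  proof -
    have "\<bar>cov (U p) (U p')\<bar> \<le> k + l + 4 * e"
      using XW[OF that(1)] XW[OF that(2)] WW k[OF that] l
      unfolding covU[OF that(1,2)] abs_le_iff by linarith
    then show ?thesis by (intro order_trans[OF covZ_le[OF that(1,2)]] mult_left_mono) auto
  qed
  have good: "\<bar>cov (Z p) (Z p')\<bar> \<le> 10 * e" if "p \<in> P" "p' \<in> P" "p \<noteq> p'" "(p, p') \<notin> B" for p p'
  proof -
    have "\<bar>cov (U p) (U p')\<bar> \<le> 5 * e"
      using XW[OF that(1)] XW[OF that(2)] WW XX[OF that]
      unfolding covU[OF that(1,2)] abs_le_iff by linarith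
    then have "2 * \<bar>cov (U p) (U p')\<bar> \<le> 2 * (5 * e)" by (intro mult_left_mono) auto
    then show ?thesis using order_trans[OF covZ_le[OF that(1,2)]] by simp
  qed
  note W[measurable]
  have ev: "{\<omega>\<in>space M. \<forall>p\<in>P. Z p \<omega> \<le> v} \<in> events"
  proof -
    have "{\<omega>\<in>space M. \<forall>p\<in>P. Z p \<omega> \<le> v} = space M - (\<Union>p\<in>P. {\<omega>\<in>space M. v < Z p \<omega>})" by (auto simp: not_le)
    moreover have "{\<omega>\<in>space M. v < Z p \<omega>} \<in> events" if "p \<in> P" for p
    proof -
      have [measurable]: "Z p \<in> borel_measurable M" unfolding Z_def by (rule measurable_H[OF scale_closed[OF U[OF that]]])
      show ?thesis by measurable
    qed
    ultimately show ?thesis using P by (auto intro!: sets.Diff sets.finite_UN)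
  qed
  have evW: "{\<omega>\<in>space M. W \<omega> < - (\<eta> * u)} \<in> events" by measurable
  \<comment> \<open>If W is not below - \<eta> u, then X p \<le> u gives U p \<le> (1 + \<eta>) u,
    and the last assumption on v turns this into Z p \<le> v. The event that W is lower is left to
    Chebyshev's inequality.\<close>
  have "prob {\<omega>\<in>space M. \<forall>p\<in>P. X p \<omega> \<le> u} \<le>
    prob ({\<omega>\<in>space M. W \<omega> < - (\<eta> * u)} \<union> {\<omega>\<in>space M. \<forall>p\<in>P. Z p \<omega> \<le> v})"
  proof (rule finite_measure_mono)
    show "{\<omega>\<in>space M. \<forall>p\<in>P. X p \<omega> \<le> u} \<subseteq>
      {\<omega>\<in>space M. W \<omega> < - (\<eta> * u)} \<union> {\<omega>\<in>space M. \<forall>p\<in>P. Z p \<omega> \<le> v}"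
    proof
      fix \<omega> assume *: "\<omega> \<in> {\<omega>\<in>space M. \<forall>p\<in>P. X p \<omega> \<le> u}"
      have "Z p \<omega> \<le> v" if "\<not> W \<omega> < - (\<eta> * u)" "p \<in> P" for p
      proof -
        have "X p \<omega> \<le> u" using * that by auto
        then have "U p \<omega> \<le> (1 + \<eta>) * u" using that by (simp add: U_def algebra_simps)
        also have "\<dots> \<le> v * sqrt (1 - \<tau>)" using \<eta> by (simp add: \<tau>_def)
        also have "\<dots> \<le> v * \<sigma> p" using \<sigma>(1)[OF that(2)] \<eta> by (intro mult_left_mono) auto
        finally show ?thesis using \<sigma>(2)[OF that(2)] by (simp add: Z_def field_simps)
      qed
      with * show "\<omega> \<in> {\<omega>\<in>space M. W \<omega> < - (\<eta> * u)} \<union> {\<omega>\<in>space M. \<forall>p\<in>P. Z p \<omega> \<le> v}" by blast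
    qed
  qed (use ev evW in auto)
  also have "\<dots> \<le> prob {\<omega>\<in>space M. W \<omega> < - (\<eta> * u)} + prob {\<omega>\<in>space M. \<forall>p\<in>P. Z p \<omega> \<le> v}"
    by (rule measure_Un_le) (use ev evW in auto)
  also have "prob {\<omega>\<in>space M. W \<omega> < - (\<eta> * u)} \<le> cov W W / (\<eta> * u)\<^sup>2"
    using \<eta> by (intro prob_lower_tail W) auto
  also have "cov W W / (\<eta> * u)\<^sup>2 \<le> (l + 2 * e) / (\<eta> * u)\<^sup>2"
    using WW by (intro divide_right_mono) auto
  also have "prob {\<omega>\<in>space M. \<forall>p\<in>P. Z p \<omega> \<le> v} \<le>
    1 / (card P * window v) + (exp (7 * (10 * e * v\<^sup>2)) - 1) + \<delta> * exp (7 * (2 * (k + l + 4 * e) * v\<^sup>2))"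
  proof (rule prob_below_bound[OF P \<eta>(3) _ _ _ _ _ B])
    show "Z p \<in> H" if "p \<in> P" for p unfolding Z_def by (rule scale_closed[OF U[OF that]])
    show "cov (Z p) (Z p) = 1" if "p \<in> P" for p
      unfolding covZ \<sigma>(3)[OF that, symmetric] using \<sigma>(2)[OF that] by (simp add: power2_eq_square)
    show "\<bar>cov (Z p) (Z p')\<bar> \<le> 1 / 2" if "p \<in> P" "p' \<in> P" "p \<noteq> p'" for p p'
      by (rule order_trans[OF offdiag[OF that]]) (use mult_left_mono[OF l(4), of 2] in simp)
    show "\<bar>cov (Z p) (Z p')\<bar> * v\<^sup>2 \<le> 2 * (k + l + 4 * e) * v\<^sup>2" if "p \<in> P" "p' \<in> P" "p \<noteq> p'" for p p'
      using offdiag[OF that] by (intro mult_right_mono) auto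
    show "\<bar>cov (Z p) (Z p')\<bar> * v\<^sup>2 \<le> 10 * e * v\<^sup>2" if "p \<in> P" "p' \<in> P" "p \<noteq> p'" "(p, p') \<notin> B" for p p'
      using good[OF that] by (intro mult_right_mono) auto
  qed
  finally show ?thesis by simp
qed

end

section \<open>Logarithmically decaying correlations and grids\<close>

lemma log_decay_upper_bound:
  fixes r :: "'a::real_normed_vector \<Rightarrow> real"
  assumes lim: "((\<lambda>t. r t * ln (norm t)) \<longlongrightarrow> R) at_infinity" and "0 \<le> R" and \<theta>: "0 < \<theta>"
  shows "\<forall>\<^sub>F u in at_top. \<forall>t. exp (\<theta> * u\<^sup>2) \<le> norm t \<longrightarrow> \<bar>r t\<bar> \<le> ((R + 1) / \<theta>) / u\<^sup>2"
proof -
  obtain b where b: "\<And>t. b \<le> norm t \<Longrightarrow> \<bar>r t * ln (norm t) - R\<bar> < 1"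
    using tendstoD[OF lim, of 1] by (auto simp: eventually_at_infinity dist_real_def)
  have "filterlim (\<lambda>u. exp (\<theta> * u\<^sup>2)) at_top at_top" using \<theta> by real_asymp
  then have "\<forall>\<^sub>F u in at_top. b \<le> exp (\<theta> * u\<^sup>2)" by (simp add: filterlim_at_top)
  then show ?thesis using eventually_gt_at_top[of 0]
  proof eventually_elim
    case (elim u)
    show ?case
    proof safe
      fix t :: 'a assume t: "exp (\<theta> * u\<^sup>2) \<le> norm t"
      have pos: "0 < \<theta> * u\<^sup>2" using \<theta> elim by simp
      have "0 < norm t" using t exp_gt_zero[of "\<theta> * u\<^sup>2"] by linarith
      then have ln: "\<theta> * u\<^sup>2 \<le> ln (norm t)" using t by (simp add: ln_ge_iff)
      have "\<bar>r t\<bar> * (\<theta> * u\<^sup>2) \<le> \<bar>r t\<bar> * ln (norm t)" using ln by (intro mult_left_mono) auto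
      also have "\<dots> = \<bar>r t * ln (norm t)\<bar>" using ln pos by (simp add: abs_mult)
      also have "\<dots> \<le> R + 1" using b[of t] t elim assms(2) by linarith
      finally show "\<bar>r t\<bar> \<le> ((R + 1) / \<theta>) / u\<^sup>2" using \<theta> elim(2) by (simp add: field_simps)
    qed
  qed
qed

text \<open>Powers of u change the logarithm of the distance only by O(ln u), which is lost against
  \<beta> u^2. The lower end of the range excludes a fraction of about 1 / u of the pairs of grid
  points; the upper end leaves room for about u^3 auxiliary points.\<close>

lemma log_decay_asymp:
  fixes r :: "'a::real_normed_vector \<Rightarrow> real"
  assumes lim: "((\<lambda>t. r t * ln (norm t)) \<longlongrightarrow> R) at_infinity" and R: "0 \<le> R"
    and \<beta>: "0 < \<beta>" and \<epsilon>: "0 < \<epsilon>"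
  shows "\<forall>\<^sub>F u in at_top. \<forall>t. exp (\<beta> * u\<^sup>2) / u \<le> norm t \<and> norm t \<le> exp (\<beta> * u\<^sup>2) * u ^ 4 \<longrightarrow>
    \<bar>r t - R / \<beta> / u\<^sup>2\<bar> \<le> \<epsilon> / u\<^sup>2"
proof -
  \<comment> \<open>The error is split below into (x - R) / a and R (\<beta> - a) / (a \<beta>). The
    first component of the minimum keeps a above \<beta> / 2, the second makes the latter part at
    most \<epsilon> / 2; R + 1 avoids a division by zero.\<close>
  define \<delta> where "\<delta> = min (\<beta> / 2) (\<epsilon> * \<beta>\<^sup>2 / (4 * (R + 1)))"
  have \<delta>: "\<delta> > 0" using \<beta> \<epsilon> R by (simp add: \<delta>_def)
  have "0 < \<epsilon> * \<beta> / 4" using \<epsilon> \<beta> by simp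
  from tendstoD[OF lim this] obtain b where b: "\<And>t. b \<le> norm t \<Longrightarrow> \<bar>r t * ln (norm t) - R\<bar> < \<epsilon> * \<beta> / 4"
    by (auto simp: eventually_at_infinity dist_real_def)
  have "filterlim (\<lambda>u. exp (\<beta> * u\<^sup>2) / u) at_top at_top" using \<beta> by real_asymp
  then have "\<forall>\<^sub>F u in at_top. b \<le> exp (\<beta> * u\<^sup>2) / u" by (simp add: filterlim_at_top)
  moreover have "((\<lambda>u::real. 4 * ln u / u\<^sup>2) \<longlongrightarrow> 0) at_top" by real_asymp
  then have "\<forall>\<^sub>F u::real in at_top. 4 * ln u / u\<^sup>2 < \<delta>" using \<delta> by (rule order_tendstoD)
  ultimately show ?thesis using eventually_gt_at_top[of 1]
  proof eventually_elim
    case (elim u)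
    show ?case
    proof safe
      fix t :: 'a assume t: "exp (\<beta> * u\<^sup>2) / u \<le> norm t" "norm t \<le> exp (\<beta> * u\<^sup>2) * u ^ 4"
      have u2: "u\<^sup>2 > 0" using elim by simp
      have "0 < exp (\<beta> * u\<^sup>2) / u" using elim by simp
      then have nt: "0 < norm t" using t(1) by linarith
      define a where "a = ln (norm t) / u\<^sup>2"
      have lnt: "ln (norm t) = a * u\<^sup>2" using u2 by (simp add: a_def)
      have "ln (exp (\<beta> * u\<^sup>2) / u) \<le> ln (norm t)" using t nt elim by simp
      then have 1: "\<beta> * u\<^sup>2 - ln u \<le> a * u\<^sup>2" using elim by (simp add: ln_div lnt)
      have "ln (norm t) \<le> ln (exp (\<beta> * u\<^sup>2) * u ^ 4)" using t nt elim by simp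
      then have 2: "a * u\<^sup>2 \<le> \<beta> * u\<^sup>2 + 4 * ln u" using elim by (simp add: ln_mult lnt ln_realpow)
      have 3: "4 * ln u \<le> \<delta> * u\<^sup>2" using elim u2 by (simp add: field_simps)
      have "0 \<le> ln u" using elim by simp
      then have "(\<beta> - \<delta>) * u\<^sup>2 \<le> a * u\<^sup>2" "a * u\<^sup>2 \<le> (\<beta> + \<delta>) * u\<^sup>2"
        using 1 2 3 by (simp_all add: algebra_simps)
      then have a: "\<beta> - \<delta> \<le> a" "a \<le> \<beta> + \<delta>" using u2 by simp_all
      have a2: "\<beta> / 2 \<le> a" using a(1) by (auto simp: \<delta>_def)
      then have a0: "a > 0" using \<beta> by linarith
      define x where "x = r t * ln (norm t)"
      have x: "\<bar>x - R\<bar> \<le> \<epsilon> * \<beta> / 4" using b[of t] t(1) elim unfolding x_def by linarith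
      have rt: "u\<^sup>2 * r t = x / a" using a0 u2 by (simp add: x_def lnt)
      have "x / a - R / \<beta> = (x - R) / a + R * (\<beta> - a) / (a * \<beta>)"
        using a0 \<beta> by (simp add: field_simps)
      also have "\<bar>\<dots>\<bar> \<le> \<bar>x - R\<bar> / a + R * \<bar>\<beta> - a\<bar> / (a * \<beta>)"
        using a0 \<beta> R by (intro order_trans[OF abs_triangle_ineq]) (simp add: abs_mult)
      also have "\<bar>x - R\<bar> / a \<le> (\<epsilon> * \<beta> / 4) / (\<beta> / 2)"
        using x a2 \<beta> \<epsilon> by (intro frac_le) auto
      also have "(\<epsilon> * \<beta> / 4) / (\<beta> / 2) = \<epsilon> / 2" using \<beta> by simp
      also have "R * \<bar>\<beta> - a\<bar> / (a * \<beta>) \<le> (R + 1) * (\<epsilon> * \<beta>\<^sup>2 / (4 * (R + 1))) / (\<beta> / 2 * \<beta>)"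
      proof (intro frac_le mult_mono mult_right_mono)
        show "\<bar>\<beta> - a\<bar> \<le> \<epsilon> * \<beta>\<^sup>2 / (4 * (R + 1))" using a by (auto simp: \<delta>_def)
      qed (use R a2 \<beta> \<epsilon> in auto)
      also have "\<dots> = \<epsilon> / 2"
      proof -
        have "c * (x / (4 * c)) = x / 4" if "c \<noteq> 0" for c x :: real using that by simp
        from this[of "R + 1" "\<epsilon> * \<beta>\<^sup>2"]
        have *: "(R + 1) * (\<epsilon> * \<beta>\<^sup>2 / (4 * (R + 1))) = \<epsilon> * \<beta>\<^sup>2 / 4" using R by linarith
        show ?thesis unfolding * using \<beta> by (simp add: power2_eq_square)
      qed
      finally have "\<bar>u\<^sup>2 * r t - R / \<beta>\<bar> \<le> \<epsilon>" by (simp add: rt)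
      moreover have "r t - R / \<beta> / u\<^sup>2 = (u\<^sup>2 * r t - R / \<beta>) / u\<^sup>2" using u2 by (simp add: field_simps)
      ultimately show "\<bar>r t - R / \<beta> / u\<^sup>2\<bar> \<le> \<epsilon> / u\<^sup>2"
        using u2 by (simp add: divide_right_mono)
    qed
  qed
qed

section \<open>Counting grid points\<close>

lemma card_nat_near:
  assumes "0 \<le> (T::real)" shows "real (card {b. \<bar>a - real b\<bar> < T}) \<le> 2 * T + 1"
proof -
  have "card {b. \<bar>a - real b\<bar> < T} = card (int ` {b. \<bar>a - real b\<bar> < T})"
    by (simp add: card_image)
  also have "\<dots> \<le> card {\<lceil>a - T\<rceil>..\<lfloor>a + T\<rfloor>}"
    by (intro card_mono) (auto simp: ceiling_le_iff le_floor_iff)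
  finally have "real (card {b. \<bar>a - real b\<bar> < T}) \<le> real (card {\<lceil>a - T\<rceil>..\<lfloor>a + T\<rfloor>})" by simp
  also have "\<dots> \<le> 2 * T + 1" using assms by (simp; linarith)
  finally show ?thesis .
qed

text \<open>Nearness is tested in the single coordinate i0, so the proportion of near points in the
  product is the proportion in that one factor.\<close>

lemma card_grid_near:
  fixes N :: "'n::finite \<Rightarrow> nat" and p :: "'n \<Rightarrow> nat" and T :: real
  defines "P \<equiv> PiE UNIV (\<lambda>i. {..<N i})"
  assumes "0 < N i0" "0 \<le> T"
  shows "real (card {p'\<in>P. \<bar>real (p i0) - real (p' i0)\<bar> < T}) \<le> (2 * T + 1) / N i0 * card P"
proof -
  let ?S = "{b\<in>{..<N i0}. \<bar>real (p i0) - real b\<bar> < T}"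
  let ?A = "(\<lambda>i. {..<N i})(i0 := ?S)"
  have fin: "finite {b. \<bar>real (p i0) - real b\<bar> < T}"
  proof (rule finite_subset[OF _ finite_atMost])
    show "{b. \<bar>real (p i0) - real b\<bar> < T} \<subseteq> {..nat \<lceil>real (p i0) + T\<rceil>}"
    proof safe
      fix b assume "\<bar>real (p i0) - real b\<bar> < T"
      then have "real b \<le> real (p i0) + T" by linarith
      then show "b \<le> nat \<lceil>real (p i0) + T\<rceil>" by linarith
    qed
  qed
  have "card {p'\<in>P. \<bar>real (p i0) - real (p' i0)\<bar> < T} \<le> card (PiE UNIV ?A)"
    by (intro card_mono finite_PiE) (auto simp: P_def PiE_def Pi_def split: if_splits)
  also have "\<dots> = (\<Prod>i\<in>UNIV. card (?A i))" by (rule card_PiE) simp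
  also have "\<dots> = card ?S * (\<Prod>i\<in>UNIV - {i0}. N i)"
    by (subst prod.remove[of _ i0]) (auto intro!: prod.cong)
  finally have "real (card {p'\<in>P. \<bar>real (p i0) - real (p' i0)\<bar> < T}) \<le> real (card ?S * (\<Prod>i\<in>UNIV - {i0}. N i))"
    by (rule of_nat_mono)
  then have 1: "real (card {p'\<in>P. \<bar>real (p i0) - real (p' i0)\<bar> < T}) \<le> real (card ?S) * real (\<Prod>i\<in>UNIV - {i0}. N i)"
    by (simp only: of_nat_mult)
  have "card ?S \<le> card {b. \<bar>real (p i0) - real b\<bar> < T}" by (rule card_mono[OF fin]) auto
  then have "real (card ?S) \<le> 2 * T + 1" using card_nat_near[OF assms(3), of "real (p i0)"] by linarith
  then have 2: "real (card ?S) * real (\<Prod>i\<in>UNIV - {i0}. N i) \<le> (2 * T + 1) * real (\<Prod>i\<in>UNIV - {i0}. N i)"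
    by (intro mult_right_mono) (auto intro: prod_nonneg)
  have "card P = N i0 * (\<Prod>i\<in>UNIV - {i0}. N i)"
    unfolding P_def by (subst card_PiE) (auto intro: prod.remove)
  then have "(2 * T + 1) * real (\<Prod>i\<in>UNIV - {i0}. N i) = (2 * T + 1) / N i0 * card P"
    using assms(2) by simp
  with 1 2 show ?thesis by linarith
qed

text \<open>A mesh width of \<open>exp (\<theta> * u\<^sup>2)\<close> keeps all correlations of order \<open>1 / u\<^sup>2\<close> at the cost of
  arbitrarily little in the exponent of the number of points.\<close>

definition grid_size :: "'n set \<Rightarrow> ('n \<Rightarrow> real) \<Rightarrow> real \<Rightarrow> real \<Rightarrow> 'n \<Rightarrow> nat" where
  "grid_size I \<gamma> \<theta> u i = (if i \<in> I then nat \<lfloor>exp ((\<gamma> i - 2 * \<theta>) * u\<^sup>2)\<rfloor> else 1)"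

text \<open>Outside \<open>I\<close> the size is 1 and only the index 0 occurs: the grid is flat in
  the directions whose sides do not grow exponentially.\<close>

definition grid_index :: "'n set \<Rightarrow> ('n \<Rightarrow> real) \<Rightarrow> real \<Rightarrow> real \<Rightarrow> ('n \<Rightarrow> nat) set" where
  "grid_index I \<gamma> \<theta> u = PiE UNIV (\<lambda>i. {..<grid_size I \<gamma> \<theta> u i})"

definition grid_point :: "real \<Rightarrow> real \<Rightarrow> ('n::finite \<Rightarrow> nat) \<Rightarrow> real ^ 'n" where
  "grid_point \<theta> u p = (\<chi> i. exp (\<theta> * u\<^sup>2) * real (p i))"

context
  fixes I :: "'n::finite set" and \<gamma> :: "'n \<Rightarrow> real" and \<theta> :: real
  assumes \<theta>: "0 < \<theta>" "\<And>i. i \<in> I \<Longrightarrow> 2 * \<theta> < \<gamma> i"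
begin

lemma grid_size_bounds:
  assumes "i \<in> I"
  shows "exp ((\<gamma> i - 2 * \<theta>) * u\<^sup>2) / 2 \<le> grid_size I \<gamma> \<theta> u i"
    and "grid_size I \<gamma> \<theta> u i \<le> exp ((\<gamma> i - 2 * \<theta>) * u\<^sup>2)"
    and "0 < grid_size I \<gamma> \<theta> u i"
proof -
  let ?E = "exp ((\<gamma> i - 2 * \<theta>) * u\<^sup>2)"
  have "1 \<le> ?E" using \<theta>(2)[OF assms] by simp
  then have 1: "1 \<le> \<lfloor>?E\<rfloor>" by (simp add: le_floor_iff)
  then have "1 \<le> real_of_int \<lfloor>?E\<rfloor>" by simp
  then have "?E / 2 \<le> of_int \<lfloor>?E\<rfloor>" using real_of_int_floor_add_one_gt[of ?E] by linarith
  with 1 show "?E / 2 \<le> grid_size I \<gamma> \<theta> u i" "grid_size I \<gamma> \<theta> u i \<le> ?E" "0 < grid_size I \<gamma> \<theta> u i"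
    using assms by (auto simp: grid_size_def)
qed

lemma grid_size_pos: "0 < grid_size I \<gamma> \<theta> u i"
  using grid_size_bounds(3) by (cases "i \<in> I") (auto simp: grid_size_def)

lemma finite_grid_index: "finite (grid_index I \<gamma> \<theta> u)"
  unfolding grid_index_def by (rule finite_PiE) auto

lemma grid_index_nonempty: "grid_index I \<gamma> \<theta> u \<noteq> {}"
  unfolding grid_index_def PiE_eq_empty_iff using grid_size_pos by (auto simp: lessThan_empty_iff)

lemma card_grid_index:
  "exp ((\<Sum>i\<in>I. \<gamma> i - 2 * \<theta>) * u\<^sup>2) / 2 ^ card I \<le> card (grid_index I \<gamma> \<theta> u)"
proof -
  have "exp ((\<Sum>i\<in>I. \<gamma> i - 2 * \<theta>) * u\<^sup>2) / 2 ^ card I = (\<Prod>i\<in>I. exp ((\<gamma> i - 2 * \<theta>) * u\<^sup>2) / 2)"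
    by (simp add: exp_sum sum_distrib_right prod_dividef)
  also have "\<dots> \<le> (\<Prod>i\<in>I. real (grid_size I \<gamma> \<theta> u i))"
    by (intro prod_mono) (use grid_size_bounds in auto)
  also have "\<dots> = (\<Prod>i\<in>UNIV. real (grid_size I \<gamma> \<theta> u i))"
    by (intro prod.mono_neutral_left) (auto simp: grid_size_def)
  also have "\<dots> = card (grid_index I \<gamma> \<theta> u)"
    by (simp add: grid_index_def card_PiE)
  finally show ?thesis .
qed

text \<open>Largest index times mesh width. The extent stays below exp (\<gamma> u^2) by a factor
  exp (- \<theta> u^2), a margin that later absorbs constants and subexponential factors of the side
  length.\<close>

lemma grid_point_nth:
  assumes "p \<in> grid_index I \<gamma> \<theta> u"
  shows "0 \<le> grid_point \<theta> u p $ i"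
    and "grid_point \<theta> u p $ i \<le> (if i \<in> I then exp ((\<gamma> i - \<theta>) * u\<^sup>2) else 0)"
proof -
  have p: "p i < grid_size I \<gamma> \<theta> u i" using assms by (auto simp: grid_index_def)
  show "0 \<le> grid_point \<theta> u p $ i" by (simp add: grid_point_def)
  show "grid_point \<theta> u p $ i \<le> (if i \<in> I then exp ((\<gamma> i - \<theta>) * u\<^sup>2) else 0)"
  proof (cases "i \<in> I")
    case True
    have "real (p i) \<le> exp ((\<gamma> i - 2 * \<theta>) * u\<^sup>2)" using p grid_size_bounds(2)[OF True, of u] by linarith
    then have "exp (\<theta> * u\<^sup>2) * real (p i) \<le> exp (\<theta> * u\<^sup>2) * exp ((\<gamma> i - 2 * \<theta>) * u\<^sup>2)"
      by (intro mult_left_mono) auto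
    also have "\<dots> = exp ((\<gamma> i - \<theta>) * u\<^sup>2)" by (simp add: exp_add[symmetric] algebra_simps)
    finally show ?thesis using True by (simp add: grid_point_def)
  qed (use p in \<open>simp add: grid_point_def grid_size_def\<close>)
qed

text \<open>The upper bounds pass through the sum norm; the resulting factor \<open>CARD('n)\<close>
  is swallowed by the power u^4 allowed in \<open>log_decay_asymp\<close>.\<close>

lemma grid_point_dist:
  assumes p: "p \<in> grid_index I \<gamma> \<theta> u" "p' \<in> grid_index I \<gamma> \<theta> u"
    and i0: "\<And>i. i \<in> I \<Longrightarrow> \<gamma> i \<le> \<gamma> i0"
  shows "norm (grid_point \<theta> u p - grid_point \<theta> u p') \<le> CARD('n) * exp ((\<gamma> i0 - \<theta>) * u\<^sup>2)"
    and "norm (grid_point \<theta> u p) \<le> CARD('n) * exp ((\<gamma> i0 - \<theta>) * u\<^sup>2)"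
    and "p \<noteq> p' \<Longrightarrow> exp (\<theta> * u\<^sup>2) \<le> norm (grid_point \<theta> u p - grid_point \<theta> u p')"
    and "exp (\<theta> * u\<^sup>2) * \<bar>real (p i) - real (p' i)\<bar> \<le> norm (grid_point \<theta> u p - grid_point \<theta> u p')"
proof -
  let ?D = "exp ((\<gamma> i0 - \<theta>) * u\<^sup>2)"
  have D: "grid_point \<theta> u q $ i \<le> ?D" if "q \<in> grid_index I \<gamma> \<theta> u" for q i
  proof -
    have "(if i \<in> I then exp ((\<gamma> i - \<theta>) * u\<^sup>2) else 0) \<le> ?D"
      using i0 by (auto intro: mult_right_mono)
    then show ?thesis using grid_point_nth(2)[OF that, of i] by linarith
  qed
  have "\<bar>(grid_point \<theta> u p - grid_point \<theta> u p') $ i\<bar> \<le> ?D" for i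
    using D[OF p(1), of i] D[OF p(2), of i] grid_point_nth(1)[OF p(1), of i] grid_point_nth(1)[OF p(2), of i]
    by auto
  then have "(\<Sum>i\<in>UNIV. \<bar>(grid_point \<theta> u p - grid_point \<theta> u p') $ i\<bar>) \<le> CARD('n) * ?D"
    by (intro sum_bounded_above) auto
  then show "norm (grid_point \<theta> u p - grid_point \<theta> u p') \<le> CARD('n) * ?D"
    using norm_le_l1_cart order_trans by blast
  have "\<bar>grid_point \<theta> u p $ i\<bar> \<le> ?D" for i
    using D[OF p(1), of i] grid_point_nth(1)[OF p(1), of i] by auto
  then have "(\<Sum>i\<in>UNIV. \<bar>grid_point \<theta> u p $ i\<bar>) \<le> CARD('n) * ?D"
    by (intro sum_bounded_above) auto
  then show "norm (grid_point \<theta> u p) \<le> CARD('n) * ?D"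
    using norm_le_l1_cart order_trans by blast
  have *: "exp (\<theta> * u\<^sup>2) * \<bar>real (p i) - real (p' i)\<bar> \<le> norm (grid_point \<theta> u p - grid_point \<theta> u p')" for i
  proof -
    have "exp (\<theta> * u\<^sup>2) * \<bar>real (p i) - real (p' i)\<bar> = \<bar>(grid_point \<theta> u p - grid_point \<theta> u p') $ i\<bar>"
      by (simp add: grid_point_def right_diff_distrib[symmetric] abs_mult)
    also have "\<dots> \<le> norm (grid_point \<theta> u p - grid_point \<theta> u p')" by (rule component_le_norm_cart)
    finally show ?thesis .
  qed
  then show "exp (\<theta> * u\<^sup>2) * \<bar>real (p i) - real (p' i)\<bar> \<le> norm (grid_point \<theta> u p - grid_point \<theta> u p')" .
  assume "p \<noteq> p'"
  then obtain i where "p i \<noteq> p' i" by auto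
  then have "1 \<le> \<bar>real (p i) - real (p' i)\<bar>" by linarith
  then have "exp (\<theta> * u\<^sup>2) * 1 \<le> exp (\<theta> * u\<^sup>2) * \<bar>real (p i) - real (p' i)\<bar>" by (intro mult_left_mono) auto
  then show "exp (\<theta> * u\<^sup>2) \<le> norm (grid_point \<theta> u p - grid_point \<theta> u p')" using *[of i] by linarith
qed

text \<open>Multiplied by the mesh width, the index distance \<open>E / u\<close> becomes the lower
  end of the range of \<open>log_decay_asymp\<close> for the exponent \<gamma> i0 - \<theta>, so
  these are the exceptional pairs. The term \<open>2 / E\<close> comes from counting whole numbers
  in an interval.\<close>

lemma card_grid_index_near:
  assumes "i0 \<in> I" "0 < u"
  defines "E \<equiv> exp ((\<gamma> i0 - 2 * \<theta>) * u\<^sup>2)"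
  shows "real (card {p'\<in>grid_index I \<gamma> \<theta> u. \<bar>real (p i0) - real (p' i0)\<bar> < E / u})
    \<le> (4 / u + 2 / E) * card (grid_index I \<gamma> \<theta> u)"
proof -
  have E: "E > 0" by (simp add: E_def)
  have "real (card {p'\<in>grid_index I \<gamma> \<theta> u. \<bar>real (p i0) - real (p' i0)\<bar> < E / u})
    \<le> (2 * (E / u) + 1) / grid_size I \<gamma> \<theta> u i0 * card (grid_index I \<gamma> \<theta> u)"
    unfolding grid_index_def by (rule card_grid_near) (use grid_size_pos E assms in auto)
  also have "(2 * (E / u) + 1) / grid_size I \<gamma> \<theta> u i0 \<le> (2 * (E / u) + 1) / (E / 2)"
    using grid_size_bounds(1)[OF assms(1), of u] E assms(2) unfolding E_def[symmetric]
    by (intro divide_left_mono) (auto intro!: mult_pos_pos add_nonneg_nonneg grid_size_pos)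
  also have "(2 * (E / u) + 1) / (E / 2) = 4 / u + 2 / E" using E assms(2) by (simp add: field_simps)
  finally show ?thesis by (simp add: mult_right_mono)
qed

end

section \<open>Exceedances on the grid\<close>

lemma norm_axis_real: "norm (axis i x :: real ^ 'n::finite) = \<bar>x\<bar>"
proof -
  have "axis i x = x *\<^sub>R (axis i 1 :: real ^ 'n)" by (simp add: axis_def vec_eq_iff)
  then show ?thesis by (simp add: norm_axis_1)
qed

lemma exists_mesh_exponent:
  fixes \<gamma> :: "'n::finite \<Rightarrow> real"
  assumes "I \<noteq> {}" "\<And>i. i \<in> I \<Longrightarrow> 0 < \<gamma> i" "1 / 2 < (\<Sum>i\<in>I. \<gamma> i)"
  shows "\<exists>\<theta>>0. (\<forall>i\<in>I. 2 * \<theta> < \<gamma> i) \<and> 1 / 2 < (\<Sum>i\<in>I. \<gamma> i - 2 * \<theta>)"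
proof -
  have card: "0 < real (card I)" using assms(1) by (simp add: card_gt_0_iff)
  \<comment> \<open>A third of the smallest exponent leaves strict room for 2 \<theta>; the second
    bound spends at most half of the surplus over 1 / 2.\<close>
  define \<theta> where "\<theta> = min (Min (\<gamma> ` I) / 3) (((\<Sum>i\<in>I. \<gamma> i) - 1 / 2) / (4 * card I))"
  have "0 < Min (\<gamma> ` I)" using assms by (simp add: Min_gr_iff)
  then have \<theta>: "0 < \<theta>" using assms(3) card by (simp add: \<theta>_def)
  have "2 * \<theta> < \<gamma> i" if "i \<in> I" for i
  proof -
    have "Min (\<gamma> ` I) \<le> \<gamma> i" using that by simp
    moreover have "\<theta> \<le> Min (\<gamma> ` I) / 3" by (simp add: \<theta>_def)
    ultimately show ?thesis using \<theta> by linarith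
  qed
  moreover have "1 / 2 < (\<Sum>i\<in>I. \<gamma> i - 2 * \<theta>)"
  proof -
    have "\<theta> \<le> ((\<Sum>i\<in>I. \<gamma> i) - 1 / 2) / (4 * card I)" by (simp add: \<theta>_def)
    then have "4 * card I * \<theta> \<le> (\<Sum>i\<in>I. \<gamma> i) - 1 / 2" using card by (simp add: field_simps)
    moreover have "(\<Sum>i\<in>I. \<gamma> i - 2 * \<theta>) = (\<Sum>i\<in>I. \<gamma> i) - 2 * card I * \<theta>" by (simp add: sum_subtractf)
    moreover have "0 < card I * \<theta>" using card \<theta> by simp
    ultimately show ?thesis by linarith
  qed
  ultimately show ?thesis using \<theta> by blast
qed

context gaussian_space
begin

text \<open>Only covariances enter, and these depend on differences of points, so one threshold for
  u serves all translations b. Each of the four terms of \<open>prob_max_le_bound\<close> is pushed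
  below \<epsilon> / 4.\<close>

lemma prob_grid_le_eventually:
  fixes X :: "real ^ 'n::finite \<Rightarrow> 'w \<Rightarrow> real" and \<gamma> :: "'n \<Rightarrow> real" and R :: real
  assumes X: "\<And>t. X t \<in> H" and r: "\<And>s t. cov (X s) (X t) = r (s - t)" and r0: "r 0 = 1"
    and R: "0 \<le> R" "((\<lambda>t. r t * ln (norm t)) \<longlongrightarrow> R) at_infinity"
    and I: "I \<noteq> {}" and \<theta>: "0 < \<theta>" "\<And>i. i \<in> I \<Longrightarrow> 2 * \<theta> < \<gamma> i"
    and sum: "1 / 2 < (\<Sum>i\<in>I. \<gamma> i - 2 * \<theta>)" and \<epsilon>: "0 < \<epsilon>"
  shows "\<forall>\<^sub>F u in at_top. \<forall>b.
    prob {\<omega>\<in>space M. \<forall>p\<in>grid_index I \<gamma> \<theta> u. X (b + grid_point \<theta> u p) \<omega> \<le> u} \<le> \<epsilon>"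
proof -
  define S where "S = (\<Sum>i\<in>I. \<gamma> i - 2 * \<theta>)"
  obtain i0 where i0: "i0 \<in> I" "\<And>i. i \<in> I \<Longrightarrow> \<gamma> i \<le> \<gamma> i0"
  proof -
    have "Max (\<gamma> ` I) \<in> \<gamma> ` I" using I by (intro Max_in) auto
    then obtain i0 where "i0 \<in> I" "\<gamma> i0 = Max (\<gamma> ` I)" by auto
    then show ?thesis by (intro that[of i0]) auto
  qed
  \<comment> \<open>About exp (S u^2) points still have many exceedances of the level a u as long as
    a^2 / 2 < S; S > 1 / 2 leaves room for a > 1.\<close>
  have "1 < sqrt (2 * S)" using sum by (simp add: S_def)
  then obtain a where a: "1 < a" "a < sqrt (2 * S)" using dense by blast
  have "a\<^sup>2 < (sqrt (2 * S))\<^sup>2" using a by (intro power_strict_mono) auto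
  then have aS: "0 < S - a\<^sup>2 / 2" using sum by (simp add: S_def)
  \<comment> \<open>Half of the gap between 1 and a is granted to the average; the rest covers the
    standard deviation of the differences, which tends to 1.\<close>
  define \<eta> where "\<eta> = (a - 1) / 2"
  have \<eta>: "0 < \<eta>" "1 + \<eta> < a" using a by (auto simp: \<eta>_def field_simps)
  \<comment> \<open>Exponent of the longest side of the grid, the scale on which nearly all
    distances lie.\<close>
  define \<beta> where "\<beta> = \<gamma> i0 - \<theta>"
  have \<beta>: "0 < \<beta>" "0 < \<gamma> i0 - 2 * \<theta>" using \<theta>(1) \<theta>(2)[OF i0(1)] by (auto simp: \<beta>_def)
  \<comment> \<open>The tolerance \<epsilon>1 is fixed before u, because the term exp (70
    \<epsilon>1 a^2) - 1 of the ordinary pairs does not depend on u and has to be made small by this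
    choice.\<close>
  have "((\<lambda>x. exp (7 * (10 * x * a\<^sup>2)) - 1) \<longlongrightarrow> exp (7 * (10 * 0 * a\<^sup>2)) - 1) (at_right 0)"
    by (intro tendsto_intros)
  then have "\<forall>\<^sub>F x in at_right 0. exp (7 * (10 * x * a\<^sup>2)) - 1 < \<epsilon> / 4"
    by (rule order_tendstoD) (use \<epsilon> in simp)
  then have "\<forall>\<^sub>F x in at_right 0. 0 < x \<and> exp (7 * (10 * x * a\<^sup>2)) - 1 < \<epsilon> / 4"
    using eventually_at_right_less by eventually_elim auto
  then obtain \<epsilon>1 :: real where \<epsilon>1: "0 < \<epsilon>1" "exp (7 * (10 * \<epsilon>1 * a\<^sup>2)) - 1 < \<epsilon> / 4"
    using eventually_happens'[OF trivial_limit_at_right_real] by blast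
  define l where "l = R / \<beta>"
  define K where "K = (R + 1) / \<theta>"
  have lK: "0 \<le> l" "0 < K" using R \<beta> \<theta> by (auto simp: l_def K_def)
  define C1 where "C1 = l + 2 * \<epsilon>1"
  define C2 where "C2 = l + 4 * \<epsilon>1"
  define C3 where "C3 = exp (7 * (2 * (K + l + 4 * \<epsilon>1) * a\<^sup>2))"
  define C4 where "C4 = 2 ^ card I * sqrt (2 * pi)"
  have C: "0 < C1" "0 < C2" "0 < C3" "0 < C4" using lK \<epsilon>1 by (auto simp: C1_def C2_def C3_def C4_def)
  have ev1: "\<forall>\<^sub>F u in at_top. C1 / u\<^sup>2 / (\<eta> * u)\<^sup>2 < \<epsilon> / 4"
  proof (rule order_tendstoD(2))
    show "((\<lambda>u. C1 / u\<^sup>2 / (\<eta> * u)\<^sup>2) \<longlongrightarrow> 0) at_top" using C \<eta> by real_asymp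
  qed (use \<epsilon> in simp)
  have ev2: "\<forall>\<^sub>F u in at_top. C4 * exp (- (S - a\<^sup>2 / 2) * u\<^sup>2 + a * u + 1 / 2) < \<epsilon> / 4"
  proof (rule order_tendstoD(2))
    show "((\<lambda>u. C4 * exp (- (S - a\<^sup>2 / 2) * u\<^sup>2 + a * u + 1 / 2)) \<longlongrightarrow> 0) at_top"
      using C aS by real_asymp
  qed (use \<epsilon> in simp)
  have ev3: "\<forall>\<^sub>F u in at_top. (4 / u + 2 / exp ((\<gamma> i0 - 2 * \<theta>) * u\<^sup>2)) * C3 < \<epsilon> / 4"
  proof (rule order_tendstoD(2))
    show "((\<lambda>u. (4 / u + 2 / exp ((\<gamma> i0 - 2 * \<theta>) * u\<^sup>2)) * C3) \<longlongrightarrow> 0) at_top"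
      using C \<beta> by real_asymp
  qed (use \<epsilon> in simp)
  have ev4: "\<forall>\<^sub>F u in at_top. (1 + \<eta>) / a < sqrt (1 - C2 / u\<^sup>2)"
  proof (rule order_tendstoD(1))
    show "((\<lambda>u. sqrt (1 - C2 / u\<^sup>2)) \<longlongrightarrow> 1) at_top" by real_asymp
  qed (use \<eta> a in simp)
  have ev5: "\<forall>\<^sub>F u in at_top. (K + C2) / u\<^sup>2 < 1 / 4"
  proof (rule order_tendstoD(2))
    show "((\<lambda>u. (K + C2) / u\<^sup>2) \<longlongrightarrow> 0) at_top" by real_asymp
  qed simp
  have ev6: "\<forall>\<^sub>F u::real in at_top. real CARD('n) + 2 * (u ^ 3 + 1) \<le> u ^ 4" by real_asymp
  have ev7: "\<forall>\<^sub>F u in at_top. 1 \<le> \<epsilon>1 / u\<^sup>2 * u ^ 3" using \<epsilon>1 by real_asymp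
  note near = log_decay_asymp[OF R(2,1) \<beta>(1) \<epsilon>1(1)] log_decay_upper_bound[OF R(2,1) \<theta>(1)]
  show ?thesis
    using eventually_gt_at_top[of 1] near ev1 ev2 ev3 ev4 ev5 ev6 ev7
  proof eventually_elim
    case (elim u)
    note near = elim(2)[rule_format, folded l_def, OF conjI] and upper = elim(3)[rule_format, folded K_def]
    define D where "D = exp (\<beta> * u\<^sup>2)"
    define P where "P = grid_index I \<gamma> \<theta> u"
    \<comment> \<open>There are enough auxiliary points for 1 / n to stay below \<epsilon>1 / u^2,
      and few enough for them to remain within distance D u^4.\<close>
    define n where "n = nat \<lceil>u ^ 3\<rceil>"
    define v where "v = a * u"
    define E where "E = exp ((\<gamma> i0 - 2 * \<theta>) * u\<^sup>2)"
    define B where "B = {(p, p'). \<bar>real (p i0) - real (p' i0)\<bar> < E / u}"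
    have u: "1 < u" by fact
    then have u2: "0 < u\<^sup>2" by simp
    have D: "0 < D" by (simp add: D_def)
    have DE: "D = exp (\<theta> * u\<^sup>2) * E" by (simp add: D_def E_def \<beta>_def exp_add[symmetric] algebra_simps)
    have Du: "D / u \<le> D" using D u by (simp add: field_simps)
    have n: "u ^ 3 \<le> real n" "real n \<le> u ^ 3 + 1" "0 < n" using u by (auto simp: n_def zero_less_ceiling; linarith?)+
    have scale: "x \<le> D * u ^ 4" if "x \<le> (CARD('n) + 2 * real n) * D" for x
    proof -
      have "2 * real n \<le> 2 * (u ^ 3 + 1)" using n(2) by simp
      then have "CARD('n) + 2 * real n \<le> u ^ 4" using elim(9) by simp
      then have "(CARD('n) + 2 * real n) * D \<le> u ^ 4 * D" using D by (intro mult_right_mono) auto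
      with that show ?thesis by (simp add: mult.commute)
    qed
    have v: "1 \<le> v" using a u mult_mono[of 1 a 1 u] by (simp add: v_def)
    \<comment> \<open>The i0 coordinates of the grid lie between 0 and D. Spacing 2 D along this
      axis, with indices from 1 on, keeps the auxiliary points at least D away from the grid and
      from each other.\<close>
    define y where "y j = axis i0 (2 * real j * D)" for j :: nat
    show ?case
    proof
      fix b
      have "prob {\<omega>\<in>space M. \<forall>p\<in>P. X (b + grid_point \<theta> u p) \<omega> \<le> u} \<le>
        (l / u\<^sup>2 + 2 * (\<epsilon>1 / u\<^sup>2)) / (\<eta> * u)\<^sup>2 + 1 / (card P * window v) + (exp (7 * (10 * (\<epsilon>1 / u\<^sup>2) * v\<^sup>2)) - 1)
          + (4 / u + 2 / E) * exp (7 * (2 * (K / u\<^sup>2 + l / u\<^sup>2 + 4 * (\<epsilon>1 / u\<^sup>2)) * v\<^sup>2))"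
      proof (rule prob_max_le_bound[where Q="{1..n}" and Y="\<lambda>j. X (b + y j)" and B=B])
        show "finite P" "P \<noteq> {}" using finite_grid_index[where I=I and \<gamma>=\<gamma> and \<theta>=\<theta> and u=u, OF \<theta>] grid_index_nonempty[where I=I and \<gamma>=\<gamma> and \<theta>=\<theta> and u=u, OF \<theta>] by (auto simp: P_def)
        show "finite {1..n}" "{1..n} \<noteq> {}" using n by auto
        show "1 \<le> \<epsilon>1 / u\<^sup>2 * real (card {1..n})"
        proof -
          have "\<epsilon>1 / u\<^sup>2 * u ^ 3 \<le> \<epsilon>1 / u\<^sup>2 * real n" using n \<epsilon>1 by (intro mult_left_mono) auto
          with elim(10) show ?thesis by simp
        qed
        show "X (b + grid_point \<theta> u p) \<in> H" "X (b + y j) \<in> H" for p j by (rule X)+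
        show "cov (X (b + grid_point \<theta> u p)) (X (b + grid_point \<theta> u p)) = 1" for p by (simp add: r r0)
        show "cov (X (b + y j)) (X (b + y j)) = 1" for j by (simp add: r r0)
        show "\<bar>cov (X (b + grid_point \<theta> u p)) (X (b + y j)) - l / u\<^sup>2\<bar> \<le> \<epsilon>1 / u\<^sup>2"
          if p: "p \<in> P" and j: "j \<in> {1..n}" for p j
        proof -
          have gi0: "grid_point \<theta> u p $ i0 \<le> D"
            using grid_point_nth(2)[where I=I and \<gamma>=\<gamma> and \<theta>=\<theta> and p=p and u=u, OF \<theta>, of i0] p i0(1) by (simp add: P_def D_def \<beta>_def)
          have "2 * 1 * D \<le> 2 * real j * D" using j D by (intro mult_right_mono) auto
          then have "D \<le> \<bar>(grid_point \<theta> u p - y j) $ i0\<bar>" using gi0 by (simp add: y_def axis_def)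
          also have "\<dots> \<le> norm (grid_point \<theta> u p - y j)" by (rule component_le_norm_cart)
          finally have 1: "D / u \<le> norm (grid_point \<theta> u p - y j)" using Du by linarith
          have "2 * real j * D \<le> 2 * real n * D" using j D by (intro mult_right_mono) auto
          then have "norm (y j) \<le> 2 * real n * D" using D by (simp add: y_def norm_axis_real)
          moreover have "norm (grid_point \<theta> u p) \<le> CARD('n) * D"
            using grid_point_dist(2)[where I=I and \<gamma>=\<gamma> and \<theta>=\<theta> and p=p and p'=p and u=u, OF \<theta> _ _ i0(2)] p by (simp add: P_def D_def \<beta>_def)
          ultimately have "norm (grid_point \<theta> u p - y j) \<le> D * u ^ 4"
            using norm_triangle_ineq4[of "grid_point \<theta> u p" "y j"] by (intro scale) (simp add: algebra_simps)
          with 1 show ?thesis using near[of "grid_point \<theta> u p - y j"] by (simp add: r D_def)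
        qed
        show "\<bar>cov (X (b + y j)) (X (b + y j')) - l / u\<^sup>2\<bar> \<le> \<epsilon>1 / u\<^sup>2"
          if j: "j \<in> {1..n}" "j' \<in> {1..n}" "j \<noteq> j'" for j j'
        proof -
          have "y j - y j' = axis i0 (2 * D * (real j - real j'))"
            by (simp add: y_def axis_def vec_eq_iff algebra_simps)
          then have norm: "norm (y j - y j') = 2 * D * \<bar>real j - real j'\<bar>" using D by (simp add: norm_axis_real abs_mult)
          have "1 \<le> \<bar>real j - real j'\<bar>" "\<bar>real j - real j'\<bar> \<le> real n" using j by auto
          then have "2 * D * 1 \<le> 2 * D * \<bar>real j - real j'\<bar>" "2 * D * \<bar>real j - real j'\<bar> \<le> 2 * D * real n"
            using D by (auto intro!: mult_left_mono)
          moreover have "2 * D * real n \<le> (CARD('n) + 2 * real n) * D" using D by (simp add: algebra_simps)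
          ultimately have "D / u \<le> norm (y j - y j')" "norm (y j - y j') \<le> D * u ^ 4"
            unfolding norm using Du D by (linarith, intro scale, linarith)
          then show ?thesis using near[of "y j - y j'"] by (simp add: r D_def)
        qed
        fix p p' assume pp: "p \<in> P" "p' \<in> P" "p \<noteq> p'"
        note dist = grid_point_dist[OF \<theta> pp(1,2)[unfolded P_def] i0(2)]
        show "\<bar>cov (X (b + grid_point \<theta> u p)) (X (b + grid_point \<theta> u p'))\<bar> \<le> K / u\<^sup>2"
          using upper[OF dist(3)[OF _ _ pp(3)]] by (simp add: r)
        assume "(p, p') \<notin> B"
        then have "exp (\<theta> * u\<^sup>2) * (E / u) \<le> exp (\<theta> * u\<^sup>2) * \<bar>real (p i0) - real (p' i0)\<bar>"
          by (intro mult_left_mono) (auto simp: B_def)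
        then have 1: "D / u \<le> norm (grid_point \<theta> u p - grid_point \<theta> u p')"
          using dist(4)[of i0] by (simp add: DE)
        have "norm (grid_point \<theta> u p - grid_point \<theta> u p') \<le> CARD('n) * D"
          using dist(1) by (simp add: D_def \<beta>_def)
        also have "\<dots> \<le> (CARD('n) + 2 * real n) * D" using D by (intro mult_right_mono) auto
        finally have 2: "norm (grid_point \<theta> u p - grid_point \<theta> u p') \<le> D * u ^ 4" by (rule scale)
        show "\<bar>cov (X (b + grid_point \<theta> u p)) (X (b + grid_point \<theta> u p')) - l / u\<^sup>2\<bar> \<le> \<epsilon>1 / u\<^sup>2"
          using near[of "grid_point \<theta> u p - grid_point \<theta> u p'"] 1 2 by (simp add: r D_def)
      next
        fix p
        show "real (card {p'\<in>P. (p, p') \<in> B}) \<le> (4 / u + 2 / E) * card P"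
          using card_grid_index_near[where I=I and \<gamma>=\<gamma> and \<theta>=\<theta> and u=u and p=p, OF \<theta> i0(1)] u by (simp add: P_def B_def E_def)
      next
        show "0 \<le> l / u\<^sup>2" "0 \<le> \<epsilon>1 / u\<^sup>2" "0 \<le> K / u\<^sup>2" using lK \<epsilon>1 by auto
        show "K / u\<^sup>2 + l / u\<^sup>2 + 4 * (\<epsilon>1 / u\<^sup>2) \<le> 1 / 4"
          using elim(8) by (simp add: C2_def add_divide_distrib)
        show "0 < \<eta>" "0 < u" "1 \<le> v" using \<eta> u v by auto
        have "l / u\<^sup>2 + 4 * (\<epsilon>1 / u\<^sup>2) = C2 / u\<^sup>2" by (simp add: C2_def add_divide_distrib)
        moreover have "(1 + \<eta>) * u = (a * u) * ((1 + \<eta>) / a)" using a by simp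
        moreover have "\<dots> \<le> (a * u) * sqrt (1 - C2 / u\<^sup>2)"
          using elim(7) a u by (intro mult_left_mono) auto
        ultimately show "(1 + \<eta>) * u \<le> v * sqrt (1 - (l / u\<^sup>2 + 4 * (\<epsilon>1 / u\<^sup>2)))"
          by (simp add: v_def)
      qed
      also have "(l / u\<^sup>2 + 2 * (\<epsilon>1 / u\<^sup>2)) / (\<eta> * u)\<^sup>2 = C1 / u\<^sup>2 / (\<eta> * u)\<^sup>2"
        by (simp add: C1_def add_divide_distrib)
      also have "7 * (10 * (\<epsilon>1 / u\<^sup>2) * v\<^sup>2) = 7 * (10 * \<epsilon>1 * a\<^sup>2)"
        using u by (simp add: v_def power_mult_distrib)
      also have "exp (7 * (2 * (K / u\<^sup>2 + l / u\<^sup>2 + 4 * (\<epsilon>1 / u\<^sup>2)) * v\<^sup>2)) = C3"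
      proof -
        have "(K / u\<^sup>2 + l / u\<^sup>2 + 4 * (\<epsilon>1 / u\<^sup>2)) * v\<^sup>2 = (K + l + 4 * \<epsilon>1) * a\<^sup>2"
          using u by (simp add: v_def power_mult_distrib add_divide_distrib[symmetric])
        then show ?thesis unfolding C3_def by (simp only: mult.assoc)
      qed
      \<comment> \<open>The number of points, at least a constant times exp (S u^2), outweighs the
        window probability of order at least exp (- (a u + 1)^2 / 2).\<close>
      also have "1 / (card P * window v) \<le> C4 * exp (- (S - a\<^sup>2 / 2) * u\<^sup>2 + a * u + 1 / 2)"
      proof -
        have "exp (S * u\<^sup>2) / 2 ^ card I * (exp (- (v + 1)\<^sup>2 / 2) / sqrt (2 * pi)) \<le> card P * window v"
          using card_grid_index[where I=I and \<gamma>=\<gamma> and \<theta>=\<theta> and u=u, OF \<theta>] window_lower_bound[OF v]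
          by (intro mult_mono) (auto simp: P_def S_def)
        then have "1 / (card P * window v) \<le> 1 / (exp (S * u\<^sup>2) / 2 ^ card I * (exp (- (v + 1)\<^sup>2 / 2) / sqrt (2 * pi)))"
          by (intro frac_le[OF _ order_refl]) auto
        also have "\<dots> = C4 * (exp (- (S * u\<^sup>2)) * exp ((v + 1)\<^sup>2 / 2))"
          by (simp add: C4_def exp_minus field_simps)
        also have "exp (- (S * u\<^sup>2)) * exp ((v + 1)\<^sup>2 / 2) = exp (- (S - a\<^sup>2 / 2) * u\<^sup>2 + a * u + 1 / 2)"
          unfolding exp_add[symmetric] by (simp add: v_def power2_eq_square field_simps)
        finally show ?thesis .
      qed
      finally show "prob {\<omega>\<in>space M. \<forall>p\<in>grid_index I \<gamma> \<theta> u. X (b + grid_point \<theta> u p) \<omega> \<le> u} \<le> \<epsilon>"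
        using elim(4-6) \<epsilon>1(2) unfolding P_def[symmetric] E_def[symmetric] by linarith
    qed
  qed
qed

end

section \<open>Reduction to a grid\<close>

lemma gaussian_process_span:
  assumes "prob_space M" and gp: "gaussian_process M UNIV X" and cp: "centered_process M UNIV X"
  shows "gaussian_space M {Y. \<exists>S c. finite S \<and> Y = (\<lambda>\<omega>. \<Sum>t\<in>S. c t * X t \<omega>)}"
proof -
  interpret prob_space M by fact
  have gX: "gaussian_rv M (X t)" for t
    using gp[unfolded gaussian_process_def, rule_format, of "{t}" "\<lambda>_. 1"] by simp
  have mX [measurable]: "X t \<in> borel_measurable M" for t
    using gX[of t] by (simp add: gaussian_rv_def)
  have EX: "expectation (X t) = 0" for t using cp by (simp add: centered_process_def)
  have iX: "integrable M (X t)" for t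
    using centered_gaussian_rv(1)[OF gX EX] by (rule square_integrable_imp_integrable[OF mX])
  define H where "H = {Y. \<exists>S c. finite S \<and> Y = (\<lambda>\<omega>. \<Sum>t\<in>S. c t * X t \<omega>)}"
  have HI: "Y \<in> H" if "finite S" "\<And>\<omega>. Y \<omega> = (\<Sum>t\<in>S. c t * X t \<omega>)" for Y S c
    unfolding H_def by (intro CollectI exI[of _ S] exI[of _ c] conjI that(1) ext that(2))
  have HE: "\<exists>S c. finite S \<and> (\<forall>\<omega>. Y \<omega> = (\<Sum>t\<in>S. c t * X t \<omega>))" if "Y \<in> H" for Y
  proof -
    from that obtain S c where "finite S" "Y = (\<lambda>\<omega>. \<Sum>t\<in>S. c t * X t \<omega>)"
      unfolding H_def by (elim CollectE exE conjE) (rule that)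
    then show ?thesis by (intro exI[of _ S] exI[of _ c]) simp
  qed
  have "gaussian_space M H"
  proof
    fix Y assume "Y \<in> H"
    then obtain S c where S: "finite S" and Y: "\<And>\<omega>. Y \<omega> = (\<Sum>t\<in>S. c t * X t \<omega>)"
      using HE by meson
    have "Y = (\<lambda>\<omega>. \<Sum>t\<in>S. c t * X t \<omega>)" by (rule ext) (rule Y)
    then show "gaussian_rv M Y"
      using gp[unfolded gaussian_process_def, rule_format, of S c] S by simp
    show "expectation Y = 0" unfolding Y using iX EX by simp
    show "(\<lambda>\<omega>. a * Y \<omega>) \<in> H" for a
      by (rule HI[OF S, of _ "\<lambda>t. a * c t"]) (simp add: Y sum_distrib_left mult.assoc)
  next
    fix Y Z assume "Y \<in> H" "Z \<in> H"
    then obtain S c S' c' where S: "finite S" "finite S'"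
      and Y: "\<And>\<omega>. Y \<omega> = (\<Sum>t\<in>S. c t * X t \<omega>)" and Z: "\<And>\<omega>. Z \<omega> = (\<Sum>t\<in>S'. c' t * X t \<omega>)"
      using HE by meson
    \<comment> \<open>Zero coefficients bring two linear combinations to a common index set.\<close>
    have extend: "(\<Sum>t\<in>U. g t * x t) = (\<Sum>t\<in>U \<union> U'. (if t \<in> U then g t else 0) * x t)"
      if "finite U" "finite U'" for U U' g and x :: "_ \<Rightarrow> real"
      using that by (intro sum.mono_neutral_cong_left) auto
    show "(\<lambda>\<omega>. Y \<omega> + Z \<omega>) \<in> H"
    proof (rule HI)
      show "finite (S \<union> S')" using S by simp
      fix \<omega>
      have 1: "Y \<omega> = (\<Sum>t\<in>S \<union> S'. (if t \<in> S then c t else 0) * X t \<omega>)"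
        unfolding Y by (rule extend[OF S])
      have 2: "Z \<omega> = (\<Sum>t\<in>S' \<union> S. (if t \<in> S' then c' t else 0) * X t \<omega>)"
        unfolding Z by (rule extend[OF S(2,1)])
      show "Y \<omega> + Z \<omega> =
        (\<Sum>t\<in>S \<union> S'. ((if t \<in> S then c t else 0) + (if t \<in> S' then c' t else 0)) * X t \<omega>)"
        unfolding 1 2 Un_commute[of S' S] distrib_right sum.distrib ..
    qed
  qed
  then show ?thesis unfolding H_def .
qed

text \<open>The shift by t moves the pair (s - t, 0) to (s, t); if s = t, the index set is a
  singleton and the argument is unchanged.\<close>

lemma stationary_expectation_mult:
  fixes X :: "'t::ab_group_add \<Rightarrow> 'w \<Rightarrow> real"
  assumes st: "stationary_field M X" and [measurable]: "\<And>t. X t \<in> borel_measurable M"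
  shows "(LINT \<omega>|M. X s \<omega> * X t \<omega>) = (LINT \<omega>|M. X (s - t) \<omega> * X 0 \<omega>)"
proof -
  let ?I = "{s - t, 0}"
  have *: "(LINT \<omega>|M. X (s - t + h) \<omega> * X (0 + h) \<omega>) =
    (LINT x|distr M (\<Pi>\<^sub>M t\<in>?I. borel) (\<lambda>\<omega>. \<lambda>t\<in>?I. X (t + h) \<omega>). x (s - t) * x 0)" for h
    by (subst integral_distr) auto
  have "(LINT \<omega>|M. X (s - t + t) \<omega> * X (0 + t) \<omega>) = (LINT \<omega>|M. X (s - t + 0) \<omega> * X (0 + 0) \<omega>)"
    unfolding * using st[unfolded stationary_field_def, rule_format, of ?I t] by simp
  then show ?thesis by simp
qed

section \<open>Exponential rates of the side lengths\<close>

lemma normal_tail_le: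
  assumes "0 \<le> u" shows "normal_tail u \<le> exp (- u\<^sup>2 / 2)"
proof -
  interpret N: real_distribution std_normal_distribution by (rule real_dist_normal_dist)
  interpret U: prob_space "density lborel (normal_density u 1)" by (rule prob_space_normal_density) simp
  have "ennreal (normal_tail u) = emeasure std_normal_distribution {u<..}"
    by (simp add: normal_tail_def N.emeasure_eq_measure)
  also have "\<dots> = (\<integral>\<^sup>+x. ennreal (std_normal_density x) * indicator {u<..} x \<partial>lborel)"
    by (simp add: emeasure_density)
  also have "\<dots> \<le> (\<integral>\<^sup>+x. ennreal (exp (- u\<^sup>2 / 2)) * ennreal (normal_density u 1 x) \<partial>lborel)"
  proof (rule nn_integral_mono)
    fix x
    show "ennreal (std_normal_density x) * indicator {u<..} x \<le> ennreal (exp (- u\<^sup>2 / 2)) * ennreal (normal_density u 1 x)"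
    proof (cases "u < x")
      case True
      \<comment> \<open>For x > u \<ge> 0 one has x^2 \<ge> u^2 + (x - u)^2, so the density is
        dominated by exp (- u^2 / 2) times the normal density centred at u, which integrates to
        1.\<close>
      have "0 \<le> (x - u) * u" using True assms by simp
      then have "- x\<^sup>2 / 2 \<le> - u\<^sup>2 / 2 + - (x - u)\<^sup>2 / 2"
        by (simp add: power2_eq_square algebra_simps)
      then have "std_normal_density x \<le> 1 / sqrt (2 * pi) * exp (- u\<^sup>2 / 2 + - (x - u)\<^sup>2 / 2)"
        unfolding std_normal_density_def by (intro mult_left_mono) auto
      also have "\<dots> = exp (- u\<^sup>2 / 2) * normal_density u 1 x"
        unfolding exp_add normal_density_def by simp
      finally show ?thesis using True by (simp add: ennreal_mult[symmetric] ennreal_leI)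
    qed simp
  qed
  also have "\<dots> = ennreal (exp (- u\<^sup>2 / 2)) * emeasure (density lborel (normal_density u 1)) UNIV"
    by (subst nn_integral_cmult) (auto simp: emeasure_density)
  also have "emeasure (density lborel (normal_density u 1)) UNIV = 1"
    using U.emeasure_space_1 by simp
  finally show ?thesis by simp
qed

text \<open>Positivity of \<open>m_fun\<close> is all that has to be known about the Pickands constants.\<close>

lemma ln_m_fun_lower_bound:
  fixes \<alpha> :: "'n::finite \<Rightarrow> real"
  assumes pos: "\<And>u. 0 < u \<Longrightarrow> 0 < m_fun \<alpha> u" and \<epsilon>: "0 < \<epsilon>"
  shows "\<forall>\<^sub>F u in at_top. (1 / 2 - \<epsilon>) * u\<^sup>2 \<le> ln (m_fun \<alpha> u)"
proof -
  define C where "C = (\<Prod>i\<in>UNIV. pickands (\<alpha> i))"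
  define s where "s = (\<Sum>i\<in>UNIV. 2 / \<alpha> i)"
  have m: "m_fun \<alpha> u = inverse (C * u powr s * normal_tail u)" if "0 < u" for u
    using that by (simp add: m_fun_def prod.distrib C_def s_def powr_sum)
  have tail: "0 \<le> normal_tail u" for u by (simp add: normal_tail_def)
  have pos': "0 < C * u powr s * normal_tail u" if "0 < u" for u
    using pos[OF that] unfolding m[OF that] inverse_positive_iff_positive .
  \<comment> \<open>Since the tail is nonnegative, positivity of the product forces both factors to
    be positive, and the logarithm of the product splits.\<close>
  have C: "0 < C" "0 < normal_tail u" if "0 < u" for u
    using pos'[OF that] tail[of u] by (auto simp: zero_less_mult_iff)
  define c where "c = ln C"
  have "((\<lambda>u::real. (c + s * ln u) / u\<^sup>2) \<longlongrightarrow> 0) at_top" by real_asymp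
  then have "\<forall>\<^sub>F u in at_top. (c + s * ln u) / u\<^sup>2 < \<epsilon>" using \<epsilon> by (rule order_tendstoD)
  then show ?thesis using eventually_gt_at_top[of 0]
  proof eventually_elim
    case (elim u)
    have "ln (m_fun \<alpha> u) = - (c + s * ln u + ln (normal_tail u))"
      using C[OF elim(2)] elim(2) by (simp add: m ln_inverse ln_mult ln_powr c_def)
    moreover have "ln (normal_tail u) \<le> ln (exp (- u\<^sup>2 / 2))"
      using normal_tail_le[of u] C(2)[OF elim(2)] elim(2) by (intro ln_mono) auto
    moreover have "c + s * ln u \<le> \<epsilon> * u\<^sup>2" using elim by (simp add: field_simps)
    ultimately show ?case by (simp add: algebra_simps)
  qed
qed

text \<open>From here on only the exponential rate of a side length matters. Positivity of f makes c
  positive, so that the logarithm of the product splits.\<close>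

lemma ln_exp_times_subexp:
  fixes f c :: "real \<Rightarrow> real"
  assumes pos: "\<And>u. 0 < u \<Longrightarrow> 0 < f u" and f: "\<And>u. 0 < u \<Longrightarrow> f u = exp (\<gamma> * u\<^sup>2) * c u"
    and c: "(\<lambda>u. ln (c u)) \<in> o[at_top](\<lambda>u. u\<^sup>2)"
  shows "((\<lambda>u. ln (f u) / u\<^sup>2) \<longlongrightarrow> \<gamma>) at_top"
proof -
  have "((\<lambda>u. ln (c u) / u\<^sup>2) \<longlongrightarrow> 0) at_top" using c by (rule smalloD_tendsto)
  then have lim: "((\<lambda>u. \<gamma> + ln (c u) / u\<^sup>2) \<longlongrightarrow> \<gamma> + 0) at_top" by (intro tendsto_intros)
  show ?thesis
  proof (rule Lim_transform_eventually)
    show "((\<lambda>u. \<gamma> + ln (c u) / u\<^sup>2) \<longlongrightarrow> \<gamma>) at_top" using lim by simp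
    show "\<forall>\<^sub>F u in at_top. \<gamma> + ln (c u) / u\<^sup>2 = ln (f u) / u\<^sup>2"
      using eventually_gt_at_top[of 0]
    proof eventually_elim
      case (elim u)
      have "0 < c u" using pos[OF elim] f[OF elim] by (simp add: zero_less_mult_iff)
      then show ?case using elim by (simp add: f ln_mult add_divide_distrib)
    qed
  qed
qed

text \<open>The logarithms of all sides add up to ln m, at least about u^2 / 2. Sides outside
  \<open>G\<close> contribute at most o(u^2), and i1 even about - \<kappa> u^2, so the growing sides
  must make up for it. The deficit \<kappa> is the source of the strict inequality on which the
  surplus of points rests.\<close>

lemma exponent_sum_gt_half:
  fixes \<alpha> \<gamma> :: "'n::finite \<Rightarrow> real" and mbar :: "'n \<Rightarrow> real \<Rightarrow> real"
  assumes pos: "\<And>i u. 0 < u \<Longrightarrow> 0 < mbar i u"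
    and prod: "\<And>u. 0 < u \<Longrightarrow> (\<Prod>i\<in>UNIV. mbar i u) = m_fun \<alpha> u"
    and G: "\<And>i. i \<in> G \<Longrightarrow> ((\<lambda>u. ln (mbar i u) / u\<^sup>2) \<longlongrightarrow> \<gamma> i) at_top"
    and i1: "i1 \<notin> G" "((\<lambda>u. ln (mbar i1 u) / u\<^sup>2) \<longlongrightarrow> - \<kappa>) at_top" and \<kappa>: "0 < \<kappa>"
    and bdd: "\<And>i. i \<notin> G \<Longrightarrow> \<exists>C. \<forall>\<^sub>F u in at_top. mbar i u \<le> C"
  shows "1 / 2 < (\<Sum>i\<in>G. \<gamma> i)"
proof -
  \<comment> \<open>The errors are one \<epsilon> from ln m, one from i1 and at most
    \<open>CARD('n)\<close> from the other sides outside \<open>G\<close>; together \<kappa> /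
    2.\<close>
  define \<epsilon> where "\<epsilon> = \<kappa> / (2 * (CARD('n) + 2))"
  have \<epsilon>: "0 < \<epsilon>" using \<kappa> by (simp add: \<epsilon>_def)
  have m_pos: "0 < m_fun \<alpha> u" if "0 < u" for u
    using prod[OF that] pos[OF that] by (metis prod_pos)
  have small: "\<forall>\<^sub>F u in at_top. ln (mbar i u) \<le> \<epsilon> * u\<^sup>2" if i: "i \<notin> G" for i
  proof -
    obtain C where C: "\<forall>\<^sub>F u in at_top. mbar i u \<le> C" using bdd[OF i] by blast
    define c where "c = ln (max C 1)"
    have "((\<lambda>u. c / u\<^sup>2) \<longlongrightarrow> 0) at_top" by real_asymp
    then have "\<forall>\<^sub>F u in at_top. c / u\<^sup>2 < \<epsilon>" using \<epsilon> by (rule order_tendstoD)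
    with C show ?thesis using eventually_gt_at_top[of 0]
    proof eventually_elim
      case (elim u)
      have "ln (mbar i u) \<le> c" unfolding c_def using elim pos[of u i] by (intro ln_mono) auto
      also have "c \<le> \<epsilon> * u\<^sup>2" using elim by (simp add: field_simps)
      finally show ?case .
    qed
  qed
  have lb: "\<forall>\<^sub>F u in at_top. (1 / 2 - \<epsilon>) * u\<^sup>2 \<le> ln (m_fun \<alpha> u)"
    by (rule ln_m_fun_lower_bound[OF _ \<epsilon>]) (rule m_pos)
  have "\<forall>\<^sub>F u in at_top. \<forall>i\<in>-G. ln (mbar i u) \<le> \<epsilon> * u\<^sup>2"
    using small by (intro eventually_ball_finite) auto
  moreover have "\<forall>\<^sub>F u in at_top. ln (mbar i1 u) / u\<^sup>2 < - \<kappa> + \<epsilon>"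
    using i1(2) \<epsilon> by (intro order_tendstoD) auto
  ultimately have "\<forall>\<^sub>F u in at_top. 1 / 2 + \<kappa> / 2 \<le> (\<Sum>i\<in>G. ln (mbar i u) / u\<^sup>2)"
    using lb eventually_gt_at_top[of 0]
  proof eventually_elim
    case (elim u)
    have u2: "0 < u\<^sup>2" using elim by simp
    have "(\<Sum>i\<in>-G. ln (mbar i u)) = ln (mbar i1 u) + (\<Sum>i\<in>-G - {i1}. ln (mbar i u))"
      by (rule sum.remove) (use i1 in auto)
    also have "(\<Sum>i\<in>-G - {i1}. ln (mbar i u)) \<le> (\<Sum>i\<in>-G - {i1}. \<epsilon> * u\<^sup>2)"
      using elim(1) by (intro sum_mono) auto
    also have "\<dots> = card (-G - {i1}) * (\<epsilon> * u\<^sup>2)" by simp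
    also have "\<dots> \<le> CARD('n) * (\<epsilon> * u\<^sup>2)"
      using \<epsilon> by (intro mult_right_mono) (auto intro!: card_mono)
    also have "ln (mbar i1 u) \<le> (- \<kappa> + \<epsilon>) * u\<^sup>2" using elim(2) u2 by (simp add: pos_divide_less_eq)
    finally have 1: "(\<Sum>i\<in>-G. ln (mbar i u)) \<le> (- \<kappa> + \<epsilon>) * u\<^sup>2 + CARD('n) * (\<epsilon> * u\<^sup>2)" by simp
    have "ln (m_fun \<alpha> u) = (\<Sum>i\<in>UNIV. ln (mbar i u))"
      unfolding prod[OF elim(4), symmetric] by (intro ln_prod) (use pos[OF elim(4)] in \<open>auto simp: less_imp_neq[symmetric]\<close>)
    also have "\<dots> = (\<Sum>i\<in>G. ln (mbar i u)) + (\<Sum>i\<in>-G. ln (mbar i u))"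
      by (subst sum.union_disjoint[symmetric]) auto
    finally have "(1 / 2 - \<epsilon>) * u\<^sup>2 - ((- \<kappa> + \<epsilon>) * u\<^sup>2 + CARD('n) * (\<epsilon> * u\<^sup>2)) \<le> (\<Sum>i\<in>G. ln (mbar i u))"
      using 1 elim(3) by linarith
    also have "(1 / 2 - \<epsilon>) * u\<^sup>2 - ((- \<kappa> + \<epsilon>) * u\<^sup>2 + CARD('n) * (\<epsilon> * u\<^sup>2)) =
        (1 / 2 + \<kappa> - (CARD('n) + 2) * \<epsilon>) * u\<^sup>2" by (simp add: algebra_simps)
    also have "(CARD('n) + 2) * \<epsilon> = \<kappa> / 2" by (simp add: \<epsilon>_def field_simps)
    finally show ?case using u2 by (simp add: sum_divide_distrib[symmetric] field_simps)
  qed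
  moreover have "((\<lambda>u. \<Sum>i\<in>G. ln (mbar i u) / u\<^sup>2) \<longlongrightarrow> (\<Sum>i\<in>G. \<gamma> i)) at_top"
    using G by (intro tendsto_sum) auto
  ultimately have "1 / 2 + \<kappa> / 2 \<le> (\<Sum>i\<in>G. \<gamma> i)"
    by (intro tendsto_lowerbound) auto
  then show ?thesis using \<kappa> by linarith
qed

section \<open>From the scaled set to the grid\<close>

lemma jordan_measurable_contains_cube:
  fixes J :: "(real ^ 'n::finite) set"
  assumes "jordan_measurable J" "0 < measure lebesgue J"
  shows "\<exists>y0 \<delta>. 0 < \<delta> \<and> (\<forall>y. (\<forall>i. \<bar>y $ i - y0 $ i\<bar> \<le> \<delta>) \<longrightarrow> y \<in> J)"
proof -
  have "interior J \<noteq> {}"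
  proof
    assume "interior J = {}"
    \<comment> \<open>Without interior points the set would lie in its boundary, a null set.\<close>
    then have "J \<subseteq> frontier J" using closure_subset[of J] by (auto simp: frontier_def)
    then have "J \<in> null_sets lebesgue"
      using assms(1) null_sets_completion_subset by (auto simp: jordan_measurable_def)
    then show False using assms(2) by (simp add: measure_def null_setsD1)
  qed
  then obtain y0 where "y0 \<in> interior J" by blast
  then obtain \<epsilon> where \<epsilon>: "0 < \<epsilon>" "ball y0 \<epsilon> \<subseteq> J" by (auto simp: mem_interior)
  \<comment> \<open>A cube is used instead of a ball because the scaling acts on each coordinate
    separately.\<close>
  define \<delta> where "\<delta> = \<epsilon> / (2 * CARD('n))"
  have \<delta>: "0 < \<delta>" "CARD('n) * \<delta> < \<epsilon>" using \<epsilon> by (auto simp: \<delta>_def)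
  have "y \<in> J" if y: "\<forall>i. \<bar>y $ i - y0 $ i\<bar> \<le> \<delta>" for y
  proof -
    have "norm (y - y0) \<le> (\<Sum>i\<in>UNIV. \<bar>(y - y0) $ i\<bar>)" by (rule norm_le_l1_cart)
    also have "\<dots> \<le> CARD('n) * \<delta>" using y by (intro sum_bounded_above) auto
    finally have "y \<in> ball y0 \<epsilon>" using \<delta> by (simp add: dist_norm norm_minus_commute)
    with \<epsilon> show ?thesis by blast
  qed
  with \<delta> show ?thesis by blast
qed

text \<open>Monotonicity asks for measurability of the larger event; a non-measurable smaller one
  would have measure 0 and satisfy the bound as well.\<close>

lemma prob_sup_le_bound:
  assumes "prob_space M" and P: "P \<subseteq> D" and B: "{\<omega>\<in>space M. \<forall>t\<in>P. X t \<omega> \<le> u} \<in> sets M"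
  shows "prob_sup_le M X D u \<le> measure M {\<omega>\<in>space M. \<forall>t\<in>P. X t \<omega> \<le> u}"
proof -
  interpret prob_space M by fact
  interpret C: finite_measure "completion M"
    by (rule finite_measureI) (simp add: emeasure_space_1)
  have "prob_sup_le M X D u \<le> measure (completion M) {\<omega>\<in>space M. \<forall>t\<in>P. X t \<omega> \<le> u}"
    unfolding prob_sup_le_def
  proof (rule C.finite_measure_mono)
    show "{\<omega> \<in> space M. (SUP t\<in>D. ereal (X t \<omega>)) \<le> ereal u} \<subseteq> {\<omega>\<in>space M. \<forall>t\<in>P. X t \<omega> \<le> u}"
      using P by (auto simp: SUP_le_iff)
  qed (use B in auto)
  then show ?thesis using B by simp
qed

theorem corollary3p6:
  fixes M :: "'w measure"
    and X :: "real ^ 'n::finite \<Rightarrow> 'w \<Rightarrow> real"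
    and r :: "real ^ 'n \<Rightarrow> real"
    and \<alpha> :: "'n \<Rightarrow> real"
    and R :: real
    and J :: "(real ^ 'n) set"
    and mbar :: "'n \<Rightarrow> real \<Rightarrow> real"
    and e :: "nat \<Rightarrow> 'n" (* enumeration of the d = CARD('n) coordinates *)
    and j k :: nat
    and \<kappa> :: real
    and c :: "real \<Rightarrow> real"
    and A :: real
  assumes "prob_space M"
    and "gaussian_process M UNIV X"
    and "centered_process M UNIV X"
    and "stationary_field M X"
    and "AE \<omega> in M. continuous_on UNIV (\<lambda>t. X t \<omega>)"
    and "\<And>t. covariance M (X t) (X t) = 1"
    and "\<And>t. r t = covariance M (X t) (X 0)"
    and "\<And>i. 0 < \<alpha> i \<and> \<alpha> i \<le> 2"
    and "0 \<le> R"
    and "(\<lambda>t. r t - (1 - (\<Sum>i\<in>UNIV. \<bar>t $ i\<bar> powr \<alpha> i)))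
           \<in> o[at 0](\<lambda>t. \<Sum>i\<in>UNIV. \<bar>t $ i\<bar> powr \<alpha> i)"
    and "((\<lambda>t. r t * ln (norm t)) \<longlongrightarrow> R) at_infinity"
    and "jordan_measurable J"
    and "measure lebesgue J > 0"
    and "bij_betw e {1..CARD('n)} UNIV"
    and "\<And>i u. 0 < u \<Longrightarrow> 0 < mbar i u"
    and "\<And>u. 0 < u \<Longrightarrow> (\<Prod>i\<in>UNIV. mbar i u) = m_fun \<alpha> u"
    and "j \<le> k" and "k < CARD('n)"
    and "\<forall>i\<in>{1..j}. (mbar (e i) \<longlongrightarrow> 0) at_top"
    and "\<forall>i\<in>{j+1..k}. \<exists>Mbar>0. (mbar (e i) \<longlongrightarrow> Mbar) at_top"
    and "\<forall>i\<in>{k+1..CARD('n)}. filterlim (mbar (e i)) at_top at_top \<and>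
           (\<exists>\<gamma> cbar. 0 \<le> \<gamma> \<and> (\<forall>u>0. mbar (e i) u = exp (\<gamma> * u^2) * cbar u) \<and>
              (\<lambda>u. ln (cbar u)) \<in> o[at_top](\<lambda>u. u^2))"
    and "0 < \<kappa>"
    and "\<And>u. 0 < u \<Longrightarrow> mbar (e 1) u = exp (- \<kappa> * u^2) * c u"
    and "(\<lambda>u. ln (c u)) \<in> o[at_top](\<lambda>u. u^2)"
    and "0 < A"
  shows "uniform_limit {x :: real ^ 'n. \<forall>i. A \<le> x $ i}
           (\<lambda>u x. prob_sup_le M X (scaled_set J x (\<lambda>i. mbar i u)) u)
           (\<lambda>x. 0) at_top"
proof -
  interpret prob_space M by fact
  note gp = assms(2) and cp = assms(3) and st = assms(4) and var = assms(6) and r_def = assms(7)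
    and mbar_pos = assms(15) and mbar_prod = assms(16)
  define H where "H = {Y. \<exists>S c. finite S \<and> Y = (\<lambda>\<omega>. \<Sum>t\<in>S. c t * X t \<omega>)}"
  interpret gaussian_space M H unfolding H_def by (rule gaussian_process_span[OF assms(1) gp cp])
  have XH: "X t \<in> H" for t
    unfolding H_def by (intro CollectI exI[of _ "{t}"] exI[of _ "\<lambda>_. 1"]) auto
  have mX [measurable]: "X t \<in> borel_measurable M" for t by (rule measurable_H[OF XH])
  have EX: "expectation (X t) = 0" for t by (rule centered[OF XH])
  have cov0: "covariance M (X s) (X t) = cov (X s) (X t)" for s t
    by (simp add: covariance_def EX)
  have cov_r: "cov (X s) (X t) = r (s - t)" for s t
    using stationary_expectation_mult[OF st mX, of s t] by (simp add: r_def cov0)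
  have r0: "r 0 = 1" using var[of 0] by (simp add: r_def)

  define G where "G = e ` {k+1..CARD('n)}"
  have e_surj: "\<exists>a\<in>{1..CARD('n)}. i = e a" for i
    using bij_betw_imp_surj_on[OF assms(14)] by blast
  have "\<forall>i\<in>G. \<exists>\<gamma>. 0 \<le> \<gamma> \<and> ((\<lambda>u. ln (mbar i u) / u\<^sup>2) \<longlongrightarrow> \<gamma>) at_top"
  proof
    fix i assume "i \<in> G"
    then obtain a where "a \<in> {k+1..CARD('n)}" "i = e a" by (auto simp: G_def)
    then obtain \<gamma> cbar where \<gamma>: "0 \<le> \<gamma>" "\<And>u. 0 < u \<Longrightarrow> mbar i u = exp (\<gamma> * u\<^sup>2) * cbar u"
      "(\<lambda>u. ln (cbar u)) \<in> o[at_top](\<lambda>u. u\<^sup>2)" using assms(21) by blast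
    have "((\<lambda>u. ln (mbar i u) / u\<^sup>2) \<longlongrightarrow> \<gamma>) at_top"
      by (rule ln_exp_times_subexp[OF mbar_pos \<gamma>(2,3)])
    with \<gamma>(1) show "\<exists>\<gamma>. 0 \<le> \<gamma> \<and> ((\<lambda>u. ln (mbar i u) / u\<^sup>2) \<longlongrightarrow> \<gamma>) at_top" by blast
  qed
  then obtain \<gamma> where \<gamma>: "\<And>i. i \<in> G \<Longrightarrow> 0 \<le> \<gamma> i"
    "\<And>i. i \<in> G \<Longrightarrow> ((\<lambda>u. ln (mbar i u) / u\<^sup>2) \<longlongrightarrow> \<gamma> i) at_top" by metis
  have e1: "((\<lambda>u. ln (mbar (e 1) u) / u\<^sup>2) \<longlongrightarrow> - \<kappa>) at_top"
    by (rule ln_exp_times_subexp[OF mbar_pos assms(23) assms(24)])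
  \<comment> \<open>Growing sides have nonnegative rates, whereas the rate of \<open>e 1\<close> is
    - \<kappa>; limits are unique.\<close>
  have "e 1 \<notin> G"
  proof
    assume "e 1 \<in> G"
    then show False using \<gamma> tendsto_unique[OF _ e1, of "\<gamma> (e 1)"] assms(22) by fastforce
  qed
  have bdd: "\<exists>C. \<forall>\<^sub>F u in at_top. mbar i u \<le> C" if i: "i \<notin> G" for i
  proof -
    obtain a where a: "a \<in> {1..CARD('n)}" "i = e a" using e_surj by blast
    have "a \<le> k"
    proof (rule ccontr)
      assume "\<not> a \<le> k"
      then have "a \<in> {k+1..CARD('n)}" using a by auto
      then show False using i a by (auto simp: G_def)
    qed
    then have "a \<in> {1..j} \<or> a \<in> {j+1..k}" using a by auto
    then obtain L where "(mbar i \<longlongrightarrow> L) at_top"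
      using assms(19,20) a by blast
    then have "\<forall>\<^sub>F u in at_top. mbar i u < L + 1" by (rule order_tendstoD) simp
    then have "\<forall>\<^sub>F u in at_top. mbar i u \<le> L + 1" by eventually_elim simp
    then show ?thesis by blast
  qed
  have "1 / 2 < (\<Sum>i\<in>G. \<gamma> i)"
    by (rule exponent_sum_gt_half[OF mbar_pos mbar_prod \<gamma>(2) \<open>e 1 \<notin> G\<close> e1 assms(22) bdd])
  \<comment> \<open>Directions with rate 0 add nothing to the sum and, growing only
    subexponentially, offer no room for a mesh of width exp (\<theta> u^2).\<close>
  define I where "I = {i\<in>G. 0 < \<gamma> i}"
  have "(\<Sum>i\<in>G. \<gamma> i) = (\<Sum>i\<in>I. \<gamma> i)"
    using \<gamma>(1) by (intro sum.mono_neutral_right) (auto simp: I_def less_le)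
  with \<open>1 / 2 < (\<Sum>i\<in>G. \<gamma> i)\<close> have sumI: "1 / 2 < (\<Sum>i\<in>I. \<gamma> i)" by simp
  then have "I \<noteq> {}" by auto
  have I: "0 < \<gamma> i" "((\<lambda>u. ln (mbar i u) / u\<^sup>2) \<longlongrightarrow> \<gamma> i) at_top" if "i \<in> I" for i
    using that \<gamma>(2) by (auto simp: I_def)
  obtain \<theta> where \<theta>: "0 < \<theta>" "\<And>i. i \<in> I \<Longrightarrow> 2 * \<theta> < \<gamma> i" "1 / 2 < (\<Sum>i\<in>I. \<gamma> i - 2 * \<theta>)"
    using exists_mesh_exponent[OF \<open>I \<noteq> {}\<close> I(1) sumI] by blast

  obtain y0 \<delta> where \<delta>: "0 < \<delta>" and J: "\<And>y. (\<And>i. \<bar>y $ i - y0 $ i\<bar> \<le> \<delta>) \<Longrightarrow> y \<in> J"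
    using jordan_measurable_contains_cube[OF assms(12,13)] by blast
  \<comment> \<open>The scaled cube has half-width at least \<delta> A mbar i in direction i. Of the
    gap \<theta> in the exponent, one half absorbs the subexponential factor of mbar i and the other
    half the constant \<delta> A.\<close>
  have "\<forall>\<^sub>F u in at_top. exp ((\<gamma> i - \<theta>) * u\<^sup>2) \<le> \<delta> * A * mbar i u" if i: "i \<in> I" for i
  proof -
    have dA: "0 < \<delta> * A" using \<delta> assms(25) by simp
    define c where "c = ln (\<delta> * A)"
    have "((\<lambda>u. c / u\<^sup>2) \<longlongrightarrow> 0) at_top" by real_asymp
    then have "\<forall>\<^sub>F u in at_top. - (\<theta> / 2) < c / u\<^sup>2" using \<theta> by (intro order_tendstoD) auto
    moreover have "\<forall>\<^sub>F u in at_top. \<gamma> i - \<theta> / 2 < ln (mbar i u) / u\<^sup>2"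
      using I(2)[OF i] \<theta> by (intro order_tendstoD) auto
    ultimately show ?thesis using eventually_gt_at_top[of 0]
    proof eventually_elim
      case (elim u)
      have "(\<gamma> i - \<theta>) * u\<^sup>2 = - (\<theta> / 2) * u\<^sup>2 + (\<gamma> i - \<theta> / 2) * u\<^sup>2" by (simp add: algebra_simps)
      also have "- (\<theta> / 2) * u\<^sup>2 \<le> c" using elim by (simp add: pos_less_divide_eq)
      also have "(\<gamma> i - \<theta> / 2) * u\<^sup>2 \<le> ln (mbar i u)" using elim by (simp add: pos_less_divide_eq)
      also have "c + ln (mbar i u) = ln (\<delta> * A * mbar i u)"
        using dA mbar_pos[OF elim(3), of i] by (subst ln_mult) (auto simp: c_def)
      finally have "(\<gamma> i - \<theta>) * u\<^sup>2 \<le> ln (\<delta> * A * mbar i u)" by simp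
      then show ?case using dA mbar_pos[OF elim(3), of i] by (simp add: ln_ge_iff)
    qed
  qed
  then have room: "\<forall>\<^sub>F u in at_top. \<forall>i\<in>I. exp ((\<gamma> i - \<theta>) * u\<^sup>2) \<le> \<delta> * A * mbar i u"
    by (intro eventually_ball_finite) auto

  show ?thesis
  proof (rule uniform_limitI)
    fix \<epsilon> :: real assume \<epsilon>: "0 < \<epsilon>"
    then have "0 < \<epsilon> / 2" by simp
    have "\<forall>\<^sub>F u in at_top. \<forall>b.
      prob {\<omega>\<in>space M. \<forall>p\<in>grid_index I \<gamma> \<theta> u. X (b + grid_point \<theta> u p) \<omega> \<le> u} \<le> \<epsilon> / 2"
      by (rule prob_grid_le_eventually[OF XH cov_r r0 assms(9,11) \<open>I \<noteq> {}\<close> \<theta>(1) _ \<theta>(3) \<open>0 < \<epsilon> / 2\<close>])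
        (rule \<theta>(2))
    then show "\<forall>\<^sub>F u in at_top. \<forall>x\<in>{x. \<forall>i. A \<le> x $ i}.
      dist (prob_sup_le M X (scaled_set J x (\<lambda>i. mbar i u)) u) 0 < \<epsilon>"
      using room eventually_gt_at_top[of 0]
    proof eventually_elim
      case (elim u)
      show ?case
      proof
        fix x :: "real ^ 'n" assume "x \<in> {x. \<forall>i. A \<le> x $ i}"
        then have x: "A \<le> x $ i" "0 < x $ i" for i using assms(25) by (auto intro: less_le_trans)
        \<comment> \<open>The image of the cube's centre under the scaling. The grid is attached
          there and extends in the positive directions only; b varies with x, which is why the grid
          estimate had to be uniform in b.\<close>
        define b where "b = (\<chi> i. x $ i * mbar i u * y0 $ i)"
        define P where "P = (\<lambda>p. b + grid_point \<theta> u p) ` grid_index I \<gamma> \<theta> u"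
        have "P \<subseteq> scaled_set J x (\<lambda>i. mbar i u)"
        proof
          fix t assume "t \<in> P"
          then obtain p where p: "p \<in> grid_index I \<gamma> \<theta> u" and t: "t = b + grid_point \<theta> u p"
            by (auto simp: P_def)
          have "\<bar>t $ i / (x $ i * mbar i u) - y0 $ i\<bar> \<le> \<delta>" for i
          proof -
            have xm: "0 < x $ i * mbar i u" using x mbar_pos[OF elim(3)] by simp
            have "grid_point \<theta> u p $ i \<le> \<delta> * (x $ i * mbar i u)"
            proof (cases "i \<in> I")
              case True
              then have "grid_point \<theta> u p $ i \<le> exp ((\<gamma> i - \<theta>) * u\<^sup>2)"
                using grid_point_nth(2)[OF \<theta>(1,2) p, of i] by simp
              also have "\<dots> \<le> \<delta> * (A * mbar i u)" using elim(2) True by (simp add: mult.assoc)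
              also have "\<dots> \<le> \<delta> * (x $ i * mbar i u)"
                using x(1)[of i] \<delta> mbar_pos[OF elim(3), of i] by (intro mult_left_mono mult_right_mono) auto
              finally show ?thesis .
            next
              case False
              then have "grid_point \<theta> u p $ i \<le> 0" using grid_point_nth(2)[OF \<theta>(1,2) p, of i] by simp
              also have "0 \<le> \<delta> * (x $ i * mbar i u)" using \<delta> xm by simp
              finally show ?thesis .
            qed
            moreover have "0 \<le> grid_point \<theta> u p $ i" by (rule grid_point_nth(1)[OF \<theta>(1,2) p])
            moreover have "t $ i / (x $ i * mbar i u) - y0 $ i = grid_point \<theta> u p $ i / (x $ i * mbar i u)"
              using x(2)[of i] mbar_pos[OF elim(3), of i] by (simp add: t b_def add_divide_distrib)
            ultimately show ?thesis using xm by (simp add: pos_divide_le_eq)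
          qed
          then show "t \<in> scaled_set J x (\<lambda>i. mbar i u)"
            unfolding scaled_set_def by (intro CollectI J) simp
        qed
        moreover have "{\<omega>\<in>space M. \<forall>t\<in>P. X t \<omega> \<le> u} \<in> events"
        proof (rule sets.sets_Collect_finite_All)
          show "finite P" unfolding P_def by (intro finite_imageI finite_grid_index[OF \<theta>(1)] \<theta>(2))
        qed measurable
        ultimately have "prob_sup_le M X (scaled_set J x (\<lambda>i. mbar i u)) u \<le> prob {\<omega>\<in>space M. \<forall>t\<in>P. X t \<omega> \<le> u}"
          by (intro prob_sup_le_bound assms(1))
        also have "\<dots> \<le> \<epsilon> / 2" using elim(1) by (simp add: P_def)
        finally show "dist (prob_sup_le M X (scaled_set J x (\<lambda>i. mbar i u)) u) 0 < \<epsilon>"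
          using \<epsilon> by (simp add: prob_sup_le_def)
      qed
    qed
  qed
qed

end
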